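(* Let $\hat{\mathfrak g}$ be the untwisted affine Lie algebra of a simple finite-dimensional complex Lie algebra $\mathfrak g$, with standard Borel subalgebra $\hat{\mathfrak b}=\hat{\mathfrak h}\oplus\hat{\mathfrak n}_+$. Let $\mathfrak i$ be a nonzero ideal of $\hat{\mathfrak b}$ contained in $\hat{\mathfrak n}_+$, of level $l$. Then $$\mathrm{supp}(\mathfrak i)=\{l\delta,(l+1)\delta\}\cup\{\alpha+(l-1)\delta:\alpha\in\mathtt a_+(\mathfrak i)\}\cup\{\alpha+l\delta:\alpha\in\mathtt a_-(\mathfrak i)\cup\mathtt a'_+(\mathfrak i)\}\cup\{\alpha+(l+1)\delta:\alpha\in\mathtt a'_-(\mathfrak i)\}\cup\bigcup_{k\ge l+1}D_k .$$
   Context: Let $\mathfrak g=\mathfrak n_-\oplus\mathfrak h\oplus\mathfrak n_+$ be a triangular decomposition, $\Delta=\Delta_+\cup\Delta_-$ the roots of $\mathfrak g$. $\hat{\mathfrak g}=\mathfrak g\otimes\mathbb C[t,t^{-1}]\oplus\mathbb Cc\oplus\mathbb Cd$ is the untwisted affine Lie algebra (universal central extension of the loop algebra, with derivation $d$, $[d,x\otimes t^k]=k\,x\otimes t^k$), $\hat{\mathfrak h}=\mathfrak h\oplus\mathbb Cc\oplus\mathbb Cd$; $\hat{\mathfrak n}_+$ is spanned by $\mathfrak n_+\otimes1$ and all $x\otimes t^k$, $x\in\mathfrak g$, $k>0$. $\hat{\mathfrak g}_\alpha$ is a root space, $\delta$ the indivisible positive imaginary root ($\hat{\mathfrak g}_{k\delta}=\mathfrak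 h\otimes t^k$ for $k\neq 0$). Put $D=\Delta_+\cup\{\delta\}\cup\{\alpha+\delta:\alpha\in\Delta_-\}$ and $D_k=D+k\delta$ for $k\ge0$; the set $\hat\Delta_+$ of roots of $\hat{\mathfrak n}_+$ is the disjoint union of the $D_k$. For an ideal $\mathfrak i$ of $\hat{\mathfrak b}$ contained in $\hat{\mathfrak n}_+$, $\mathrm{supp}(\mathfrak i)=\{\alpha\in\hat\Delta_+:\mathfrak i\cap\hat{\mathfrak g}_\alpha\ne0\}$. The *level* of a nonzero such ideal is the minimal positive integer $l$ with $l\delta\in\mathrm{supp}(\mathfrak i)$. For $\mathfrak i$ of level $l$ put - $\mathtt a_+(\mathfrak i)=\{\alpha\in\Delta_+:\alpha+(l-1)\delta\in\mathrm{supp}(\mathfrak i)\}$, - $\mathtt a_-(\mathfrak i)=\{\alpha\in\Delta_-:\alpha+l\delta\in\mathrm{supp}(\mathfrak i)\}$, - $\mathtt a'_+(\mathfrak i)=\{\alpha\in\Delta_+:\alpha+l\delta\in\mathrm{supp}(\mathfrak i)\}$, - $\mathtt a'_-(\mathfrak i)=\{\alpha\in\Delta_-:\alpha+(l+1)\delta\in\mathrm{supp}(\mathfrak i)\}$. *)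

theory Defs
  imports
    Complex_Main
    "HOL-Library.Poly_Mapping"
    "HOL-Library.Product_Plus"
    "HOL-Library.Function_Algebras"
begin

section \<open>Lie algebras\<close>

locale lie_algebra = vector_space scale
  for scale :: "'k::field \<Rightarrow> 'a::ab_group_add \<Rightarrow> 'a" (infixr \<open>*s\<close> 75) +
  fixes br :: "'a \<Rightarrow> 'a \<Rightarrow> 'a"
  assumes br_add_left: "br (x + y) z = br x z + br y z"
    and br_add_right: "br x (y + z) = br x y + br x z"
    and br_scale_left: "br (c *s x) y = c *s br x y"
    and br_scale_right: "br x (c *s y) = c *s br x y"
    and br_self: "br x x = 0"
    and jacobi: "br x (br y z) + br y (br z x) + br z (br x y) = 0"
begin

definition subalgebra :: "'a set \<Rightarrow> bool" where
  "subalgebra H \<longleftrightarrow> subspace H \<and> (\<forall>x\<in>H. \<forall>y\<in>H. br x y \<in> H)"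

definition ideal_of :: "'a set \<Rightarrow> 'a set \<Rightarrow> bool" where
  "ideal_of B I \<longleftrightarrow> subspace I \<and> I \<subseteq> B \<and> (\<forall>x\<in>B. \<forall>y\<in>I. br x y \<in> I)"

definition simple_lie_algebra :: bool where
  "simple_lie_algebra \<longleftrightarrow>
     (\<exists>x y. br x y \<noteq> 0) \<and> (\<forall>I. ideal_of UNIV I \<longrightarrow> I = {0} \<or> I = UNIV)"

definition ad_diagonalizable :: "'a \<Rightarrow> bool" where
  "ad_diagonalizable x \<longleftrightarrow> span {y. \<exists>c. br x y = c *s y} = UNIV"

definition toral :: "'a set \<Rightarrow> bool" where
  "toral H \<longleftrightarrow> subalgebra H \<and> (\<forall>x\<in>H. \<forall>y\<in>H. br x y = 0) \<and> (\<forall>x\<in>H. ad_diagonalizable x)"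

text \<open>Over \<open>\<complex>\<close> the Cartan subalgebras of a semisimple Lie algebra are the maximal toral ones.\<close>

definition cartan_subalgebra :: "'a set \<Rightarrow> bool" where
  "cartan_subalgebra H \<longleftrightarrow> toral H \<and> (\<forall>T. toral T \<and> H \<subseteq> T \<longrightarrow> T = H)"

text \<open>
  The dual space of a subspace \<open>H\<close>. A functional on \<open>H\<close> is represented by the function on the
  whole type that vanishes outside \<open>H\<close>; with this normalisation equality of functionals
  is equality of functions, and sums, negatives and multiples are pointwise.
\<close>

definition dual_space :: "'a set \<Rightarrow> ('a \<Rightarrow> 'k) set" where
  "dual_space H = {\<alpha>. (\<forall>x. x \<notin> H \<longrightarrow> \<alpha> x = 0) \<and>
     (\<forall>x\<in>H. \<forall>y\<in>H. \<alpha> (x + y) = \<alpha> x + \<alpha> y) \<and> (\<forall>c. \<forall>x\<in>H. \<alpha> (c *s x) = c * \<alpha> x)}"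

definition root_space :: "'a set \<Rightarrow> ('a \<Rightarrow> 'k) \<Rightarrow> 'a set" where
  "root_space H \<alpha> = {x. \<forall>h\<in>H. br h x = \<alpha> h *s x}"

definition roots :: "'a set \<Rightarrow> ('a \<Rightarrow> 'k) set" where
  "roots H = {\<alpha> \<in> dual_space H. \<alpha> \<noteq> 0 \<and> root_space H \<alpha> \<noteq> {0}}"

lemma br_zero_left [simp]: "br 0 x = 0"
  using br_add_left[of 0 0 x] by simp

lemma br_zero_right [simp]: "br x 0 = 0"
  using br_add_right[of x 0 0] by simp

lemma br_swap: "br x y = - br y x"
proof -
  have "br (x + y) (x + y) = (br x x + br x y) + (br y x + br y y)"
    by (simp only: br_add_left br_add_right ac_simps)
  then have "br x y + br y x = 0" by (simp add: br_self)
  then show ?thesis by (simp only: eq_neg_iff_add_eq_0)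
qed

lemma br_minus_left [simp]: "br (- x) y = - br x y"
  using br_add_left[of x "- x" y] by (simp add: eq_neg_iff_add_eq_0 add.commute)

lemma br_minus_right [simp]: "br x (- y) = - br x y"
  using br_add_right[of x y "- y"] by (simp add: eq_neg_iff_add_eq_0 add.commute)

end


section \<open>Triangular decompositions\<close>

text \<open>
  The Lie algebra has the whole type \<open>'a\<close> as its carrier. The component \<open>form\<close> is the invariant
  bilinear form that enters the central term of the affine bracket; for a simple Lie algebra every
  nondegenerate choice yields the universal central extension of the loop algebra, up to
  isomorphism.
\<close>

record 'a triangular_datum =
  smult :: "complex \<Rightarrow> 'a \<Rightarrow> 'a"
  bracket :: "'a \<Rightarrow> 'a \<Rightarrow> 'a"
  form :: "'a \<Rightarrow> 'a \<Rightarrow> complex"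
  cartan :: "'a set"
  pos_roots :: "('a \<Rightarrow> complex) set"

definition neg_roots :: "'a::ab_group_add triangular_datum \<Rightarrow> ('a \<Rightarrow> complex) set" where
  "neg_roots G = uminus ` pos_roots G"

definition n_plus :: "'a::ab_group_add triangular_datum \<Rightarrow> 'a set" where
  "n_plus G = module.span (smult G)
     (\<Union>\<alpha>\<in>pos_roots G. lie_algebra.root_space (smult G) (bracket G) (cartan G) \<alpha>)"

definition n_minus :: "'a::ab_group_add triangular_datum \<Rightarrow> 'a set" where
  "n_minus G = module.span (smult G)
     (\<Union>\<alpha>\<in>neg_roots G. lie_algebra.root_space (smult G) (bracket G) (cartan G) \<alpha>)"

locale simple_triangular = lie_algebra "smult G" "bracket G"
  for G :: "'a::ab_group_add triangular_datum" +
  assumes finite_dim: "\<exists>B. finite B \<and> span B = UNIV"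
    and simple: "simple_lie_algebra"
    and form_add_left: "form G (x + y) z = form G x z + form G y z"
    and form_scale_left: "form G (smult G c x) y = c * form G x y"
    and form_sym: "form G x y = form G y x"
    and form_invariant: "form G (bracket G x y) z = form G x (bracket G y z)"
    and form_nondegenerate: "(\<forall>y. form G x y = 0) \<Longrightarrow> x = 0"
    and cartan: "cartan_subalgebra (cartan G)"
    and roots_eq: "roots (cartan G) = pos_roots G \<union> neg_roots G"
    and pos_neg_disjoint: "pos_roots G \<inter> neg_roots G = {}"
    and pos_roots_closed: "\<lbrakk>\<alpha> \<in> pos_roots G; \<beta> \<in> pos_roots G; \<alpha> + \<beta> \<in> roots (cartan G)\<rbrakk>
          \<Longrightarrow> \<alpha> + \<beta> \<in> pos_roots G"
    and triangular: "bij_betw (\<lambda>(y, h, x). y + h + x) (n_minus G \<times> cartan G \<times> n_plus G) UNIV"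


section \<open>The untwisted affine Lie algebra\<close>

text \<open>
  The triple \<open>(f, a, b)\<close> stands for \<open>(\<Sum>k. f k \<otimes> t^k) + a c + b d\<close>. The bracket is
  \<open>[x \<otimes> t^m, y \<otimes> t^n] = [x,y] \<otimes> t^(m+n) + m \<delta>(m,-n) (x|y) c\<close> (Kronecker delta),
  \<open>[d, x \<otimes> t^m] = m x \<otimes> t^m\<close>, with \<open>c\<close> central.
\<close>

type_synonym 'a affine = "(int \<Rightarrow>\<^sub>0 'a) \<times> complex \<times> complex"

definition loop_smult ::
    "'a::ab_group_add triangular_datum \<Rightarrow> complex \<Rightarrow> (int \<Rightarrow>\<^sub>0 'a) \<Rightarrow> (int \<Rightarrow>\<^sub>0 'a)" where
  "loop_smult G z f = Poly_Mapping.map (smult G z) f"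

definition loop_deriv ::
    "'a::ab_group_add triangular_datum \<Rightarrow> (int \<Rightarrow>\<^sub>0 'a) \<Rightarrow> (int \<Rightarrow>\<^sub>0 'a)" where
  "loop_deriv G f = (\<Sum>m\<in>Poly_Mapping.keys f. Poly_Mapping.single m (smult G (of_int m) (Poly_Mapping.lookup f m)))"

definition loop_bracket ::
    "'a::ab_group_add triangular_datum \<Rightarrow> (int \<Rightarrow>\<^sub>0 'a) \<Rightarrow> (int \<Rightarrow>\<^sub>0 'a) \<Rightarrow> (int \<Rightarrow>\<^sub>0 'a)" where
  "loop_bracket G f g = (\<Sum>m\<in>Poly_Mapping.keys f. \<Sum>n\<in>Poly_Mapping.keys g.
     Poly_Mapping.single (m + n) (bracket G (Poly_Mapping.lookup f m) (Poly_Mapping.lookup g n)))"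

definition loop_cocycle ::
    "'a::ab_group_add triangular_datum \<Rightarrow> (int \<Rightarrow>\<^sub>0 'a) \<Rightarrow> (int \<Rightarrow>\<^sub>0 'a) \<Rightarrow> complex" where
  "loop_cocycle G f g = (\<Sum>m\<in>Poly_Mapping.keys f. of_int m * form G (Poly_Mapping.lookup f m) (Poly_Mapping.lookup g (- m)))"

fun hat_smult ::
    "'a::ab_group_add triangular_datum \<Rightarrow> complex \<Rightarrow> 'a affine \<Rightarrow> 'a affine" where
  "hat_smult G z (f, a, b) = (loop_smult G z f, z * a, z * b)"

fun hat_bracket ::
    "'a::ab_group_add triangular_datum \<Rightarrow> 'a affine \<Rightarrow> 'a affine \<Rightarrow> 'a affine" where
  "hat_bracket G (f, a, b) (g, a', b') =
     (loop_bracket G f g + loop_smult G b (loop_deriv G g) - loop_smult G b' (loop_deriv G f),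
      loop_cocycle G f g, 0)"

definition tensor_t :: "'a::ab_group_add \<Rightarrow> int \<Rightarrow> 'a affine" where
  "tensor_t x k = (Poly_Mapping.single k x, 0, 0)"

definition hat_cartan :: "'a::ab_group_add triangular_datum \<Rightarrow> 'a affine set" where
  "hat_cartan G = {(Poly_Mapping.single 0 h, a, b) | h a b. h \<in> cartan G}"

definition hat_n_plus :: "'a::ab_group_add triangular_datum \<Rightarrow> 'a affine set" where
  "hat_n_plus G = module.span (hat_smult G)
     ({tensor_t x 0 | x. x \<in> n_plus G} \<union> {tensor_t x k | x k. k > 0})"

definition hat_borel :: "'a::ab_group_add triangular_datum \<Rightarrow> 'a affine set" where
  "hat_borel G = {h + x | h x. h \<in> hat_cartan G \<and> x \<in> hat_n_plus G}"


section \<open>Affine roots\<close>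

definition hat_root_space ::
    "'a::ab_group_add triangular_datum \<Rightarrow> ('a affine \<Rightarrow> complex) \<Rightarrow> 'a affine set" where
  "hat_root_space G = lie_algebra.root_space (hat_smult G) (hat_bracket G) (hat_cartan G)"

definition hat_pos_roots ::
    "'a::ab_group_add triangular_datum \<Rightarrow> ('a affine \<Rightarrow> complex) set" where
  "hat_pos_roots G = {\<alpha> \<in> lie_algebra.roots (hat_smult G) (hat_bracket G) (hat_cartan G).
     hat_n_plus G \<inter> hat_root_space G \<alpha> \<noteq> {0}}"

text \<open>
  A functional on the finite Cartan subalgebra, extended by zero on \<open>c\<close> and \<open>d\<close>.
\<close>

definition lift ::
    "'a::ab_group_add triangular_datum \<Rightarrow> ('a \<Rightarrow> complex) \<Rightarrow> 'a affine \<Rightarrow> complex" where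
  "lift G \<alpha> = (\<lambda>x. if x \<in> hat_cartan G then \<alpha> (Poly_Mapping.lookup (fst x) 0) else 0)"

text \<open>
  The multiple \<open>k\<delta>\<close>, where \<open>\<delta>\<close> is the functional with \<open>\<delta>(d) = 1\<close> that vanishes
  on the finite Cartan subalgebra and on \<open>c\<close>.
\<close>

definition mult_delta ::
    "'a::ab_group_add triangular_datum \<Rightarrow> int \<Rightarrow> 'a affine \<Rightarrow> complex" where
  "mult_delta G k = (\<lambda>x. if x \<in> hat_cartan G then of_int k * snd (snd x) else 0)"

definition D :: "'a::ab_group_add triangular_datum \<Rightarrow> ('a affine \<Rightarrow> complex) set" where
  "D G = lift G ` pos_roots G \<union> {mult_delta G 1} \<union> {lift G \<alpha> + mult_delta G 1 | \<alpha>. \<alpha> \<in> neg_roots G}"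

definition D_shift ::
    "'a::ab_group_add triangular_datum \<Rightarrow> nat \<Rightarrow> ('a affine \<Rightarrow> complex) set" where
  "D_shift G k = {\<beta> + mult_delta G (int k) | \<beta>. \<beta> \<in> D G}"


section \<open>Supports and levels\<close>

definition supp ::
    "'a::ab_group_add triangular_datum \<Rightarrow> 'a affine set \<Rightarrow> ('a affine \<Rightarrow> complex) set" where
  "supp G I = {\<alpha> \<in> hat_pos_roots G. I \<inter> hat_root_space G \<alpha> \<noteq> {0}}"

definition level :: "'a::ab_group_add triangular_datum \<Rightarrow> 'a affine set \<Rightarrow> nat" where
  "level G I = (LEAST l. 0 < l \<and> mult_delta G (int l) \<in> supp G I)"

definition a_plus ::
    "'a::ab_group_add triangular_datum \<Rightarrow> 'a affine set \<Rightarrow> ('a \<Rightarrow> complex) set" where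
  "a_plus G I = {\<alpha> \<in> pos_roots G. lift G \<alpha> + mult_delta G (int (level G I) - 1) \<in> supp G I}"

definition a_minus ::
    "'a::ab_group_add triangular_datum \<Rightarrow> 'a affine set \<Rightarrow> ('a \<Rightarrow> complex) set" where
  "a_minus G I = {\<alpha> \<in> neg_roots G. lift G \<alpha> + mult_delta G (int (level G I)) \<in> supp G I}"

definition a_plus' ::
    "'a::ab_group_add triangular_datum \<Rightarrow> 'a affine set \<Rightarrow> ('a \<Rightarrow> complex) set" where
  "a_plus' G I = {\<alpha> \<in> pos_roots G. lift G \<alpha> + mult_delta G (int (level G I)) \<in> supp G I}"

definition a_minus' ::
    "'a::ab_group_add triangular_datum \<Rightarrow> 'a affine set \<Rightarrow> ('a \<Rightarrow> complex) set" where
  "a_minus' G I = {\<alpha> \<in> neg_roots G. lift G \<alpha> + mult_delta G (int (level G I) + 1) \<in> supp G I}"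


section \<open>The affine algebra is a Lie algebra\<close>

context simple_triangular
begin

lemma form_add_right: "form G x (y + z) = form G x y + form G x z"
  using form_add_left form_sym by metis

lemma form_zero_left [simp]: "form G 0 x = 0"
  using form_add_left[of 0 0 x] by simp

lemma form_zero_right [simp]: "form G x 0 = 0"
  using form_zero_left form_sym by metis

lemma form_scale_right: "form G x (smult G c y) = c * form G x y"
  using form_scale_left form_sym by metis

lemma loop_deriv_super:
  assumes "finite K" "Poly_Mapping.keys f \<subseteq> K"
  shows "loop_deriv G f = (\<Sum>m\<in>K. Poly_Mapping.single m (smult G (of_int m) (Poly_Mapping.lookup f m)))"
  unfolding loop_deriv_def
  by (rule sum.mono_neutral_left) (use assms in \<open>auto simp: in_keys_iff\<close>)

lemma loop_bracket_super:
  assumes "finite K" "Poly_Mapping.keys f \<subseteq> K" "finite L" "Poly_Mapping.keys g \<subseteq> L"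
  shows "loop_bracket G f g = (\<Sum>m\<in>K. \<Sum>n\<in>L.
     Poly_Mapping.single (m + n) (bracket G (Poly_Mapping.lookup f m) (Poly_Mapping.lookup g n)))"
proof -
  have "loop_bracket G f g = (\<Sum>m\<in>Poly_Mapping.keys f. \<Sum>n\<in>L.
     Poly_Mapping.single (m + n) (bracket G (Poly_Mapping.lookup f m) (Poly_Mapping.lookup g n)))"
    unfolding loop_bracket_def
    by (rule sum.cong[OF refl], rule sum.mono_neutral_left)
      (use assms in \<open>auto simp: in_keys_iff\<close>)
  also have "\<dots> = (\<Sum>m\<in>K. \<Sum>n\<in>L.
     Poly_Mapping.single (m + n) (bracket G (Poly_Mapping.lookup f m) (Poly_Mapping.lookup g n)))"
    by (rule sum.mono_neutral_left) (use assms in \<open>auto simp: in_keys_iff\<close>)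
  finally show ?thesis .
qed

lemma loop_cocycle_super:
  assumes "finite K" "Poly_Mapping.keys f \<subseteq> K"
  shows "loop_cocycle G f g = (\<Sum>m\<in>K. of_int m * form G (Poly_Mapping.lookup f m) (Poly_Mapping.lookup g (- m)))"
  unfolding loop_cocycle_def
  by (rule sum.mono_neutral_left) (use assms in \<open>auto simp: in_keys_iff\<close>)

lemma lookup_loop_smult: "Poly_Mapping.lookup (loop_smult G z f) k = smult G z (Poly_Mapping.lookup f k)"
  by (simp add: loop_smult_def Poly_Mapping.map.rep_eq when_def)

lemma lookup_loop_deriv: "Poly_Mapping.lookup (loop_deriv G f) k = smult G (of_int k) (Poly_Mapping.lookup f k)"
proof -
  have "Poly_Mapping.lookup (loop_deriv G f) k
      = (\<Sum>m\<in>insert k (Poly_Mapping.keys f). Poly_Mapping.lookup (Poly_Mapping.single m (smult G (of_int m) (Poly_Mapping.lookup f m))) k)"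
    by (subst loop_deriv_super[of "insert k (Poly_Mapping.keys f)"]) (auto simp: lookup_sum)
  also have "\<dots> = (\<Sum>m\<in>insert k (Poly_Mapping.keys f). if m = k then smult G (of_int k) (Poly_Mapping.lookup f k) else 0)"
    by (rule sum.cong) (auto simp: lookup_single when_def)
  finally show ?thesis by (simp add: sum.delta)
qed

lemma loop_smult_single: "loop_smult G z (Poly_Mapping.single m x) = Poly_Mapping.single m (smult G z x)"
  by (rule poly_mapping_eqI) (simp add: lookup_loop_smult lookup_single when_def)

lemma loop_deriv_single:
  "loop_deriv G (Poly_Mapping.single m x) = Poly_Mapping.single m (smult G (of_int m) x)"
  by (rule poly_mapping_eqI) (simp add: lookup_loop_deriv lookup_single when_def)

lemma loop_smult_add: "loop_smult G z (f + g) = loop_smult G z f + loop_smult G z g"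
  by (rule poly_mapping_eqI) (simp add: lookup_loop_smult lookup_add scale_right_distrib)

lemma loop_smult_add_left: "loop_smult G (y + z) f = loop_smult G y f + loop_smult G z f"
  by (rule poly_mapping_eqI) (simp add: lookup_loop_smult lookup_add scale_left_distrib)

lemma loop_smult_loop_smult: "loop_smult G y (loop_smult G z f) = loop_smult G (y * z) f"
  by (rule poly_mapping_eqI) (simp add: lookup_loop_smult)

lemma loop_smult_one: "loop_smult G 1 f = f"
  by (rule poly_mapping_eqI) (simp add: lookup_loop_smult)

lemma loop_smult_zero [simp]: "loop_smult G z 0 = 0"
  by (rule poly_mapping_eqI) (simp add: lookup_loop_smult)

lemma loop_smult_zero_left [simp]: "loop_smult G 0 f = 0"
  by (rule poly_mapping_eqI) (simp add: lookup_loop_smult)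

lemma loop_smult_diff: "loop_smult G z (f - g) = loop_smult G z f - loop_smult G z g"
  by (rule poly_mapping_eqI) (simp add: lookup_loop_smult lookup_minus scale_right_diff_distrib)

lemma loop_deriv_add: "loop_deriv G (f + g) = loop_deriv G f + loop_deriv G g"
  by (rule poly_mapping_eqI) (simp add: lookup_loop_deriv lookup_add scale_right_distrib)

lemma loop_deriv_zero [simp]: "loop_deriv G 0 = 0"
  by (rule poly_mapping_eqI) (simp add: lookup_loop_deriv)

lemma loop_deriv_smult: "loop_deriv G (loop_smult G z f) = loop_smult G z (loop_deriv G f)"
  by (rule poly_mapping_eqI) (simp add: lookup_loop_deriv lookup_loop_smult mult.commute)

lemma loop_bracket_add_left: "loop_bracket G (f + g) h = loop_bracket G f h + loop_bracket G g h"
proof -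
  have *: "finite (Poly_Mapping.keys f \<union> Poly_Mapping.keys g)" "Poly_Mapping.keys f \<subseteq> Poly_Mapping.keys f \<union> Poly_Mapping.keys g" "Poly_Mapping.keys g \<subseteq> Poly_Mapping.keys f \<union> Poly_Mapping.keys g"
      "Poly_Mapping.keys (f + g) \<subseteq> Poly_Mapping.keys f \<union> Poly_Mapping.keys g" "finite (Poly_Mapping.keys h)" "Poly_Mapping.keys h \<subseteq> Poly_Mapping.keys h"
    using Poly_Mapping.keys_add[of f g] by auto
  show ?thesis
    by (simp add: loop_bracket_super[OF *(1,2,5,6)] loop_bracket_super[OF *(1,3,5,6)]
        loop_bracket_super[OF *(1,4,5,6)] lookup_add br_add_left single_add sum.distrib)
qed

lemma loop_bracket_add_right: "loop_bracket G h (f + g) = loop_bracket G h f + loop_bracket G h g"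
proof -
  have *: "finite (Poly_Mapping.keys f \<union> Poly_Mapping.keys g)" "Poly_Mapping.keys f \<subseteq> Poly_Mapping.keys f \<union> Poly_Mapping.keys g" "Poly_Mapping.keys g \<subseteq> Poly_Mapping.keys f \<union> Poly_Mapping.keys g"
      "Poly_Mapping.keys (f + g) \<subseteq> Poly_Mapping.keys f \<union> Poly_Mapping.keys g" "finite (Poly_Mapping.keys h)" "Poly_Mapping.keys h \<subseteq> Poly_Mapping.keys h"
    using Poly_Mapping.keys_add[of f g] by auto
  show ?thesis
    by (simp add: loop_bracket_super[OF *(5,6,1,2)] loop_bracket_super[OF *(5,6,1,3)]
        loop_bracket_super[OF *(5,6,1,4)] lookup_add br_add_right single_add sum.distrib)
qed

lemma loop_bracket_zero [simp]: "loop_bracket G 0 f = 0" "loop_bracket G f 0 = 0"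
  by (simp_all add: loop_bracket_def)

lemma loop_bracket_single: "loop_bracket G (Poly_Mapping.single m x) (Poly_Mapping.single n y)
    = Poly_Mapping.single (m + n) (bracket G x y)"
  by (subst loop_bracket_super[of "{m}" _ "{n}"]) auto

lemma loop_cocycle_add_left: "loop_cocycle G (f + g) h = loop_cocycle G f h + loop_cocycle G g h"
proof -
  have *: "finite (Poly_Mapping.keys f \<union> Poly_Mapping.keys g)" "Poly_Mapping.keys f \<subseteq> Poly_Mapping.keys f \<union> Poly_Mapping.keys g" "Poly_Mapping.keys g \<subseteq> Poly_Mapping.keys f \<union> Poly_Mapping.keys g"
      "Poly_Mapping.keys (f + g) \<subseteq> Poly_Mapping.keys f \<union> Poly_Mapping.keys g"
    using Poly_Mapping.keys_add[of f g] by auto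
  show ?thesis
    by (simp add: loop_cocycle_super[OF *(1,2)] loop_cocycle_super[OF *(1,3)]
        loop_cocycle_super[OF *(1,4)] lookup_add form_add_left distrib_left sum.distrib)
qed

lemma loop_cocycle_add_right: "loop_cocycle G h (f + g) = loop_cocycle G h f + loop_cocycle G h g"
  by (simp add: loop_cocycle_def lookup_add form_add_right distrib_left sum.distrib)

lemma loop_cocycle_zero [simp]: "loop_cocycle G 0 f = 0" "loop_cocycle G f 0 = 0"
  by (simp_all add: loop_cocycle_def)

lemma loop_cocycle_single: "loop_cocycle G (Poly_Mapping.single m x) (Poly_Mapping.single n y)
    = (if m + n = 0 then of_int m * form G x y else 0)"
  by (subst loop_cocycle_super[of "{m}"]) (auto simp: lookup_single when_def)

lemma hat_induct [case_names single c d add]: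
  assumes single: "\<And>m x. P (Poly_Mapping.single m x, 0, 0)"
    and c: "\<And>a. P (0, a, 0)" and d: "\<And>b. P (0, 0, b)"
    and add: "\<And>u v. P u \<Longrightarrow> P v \<Longrightarrow> P (u + v)"
  shows "P (u :: 'a affine)"
proof -
  obtain f a b where u: "u = (f, a, b)" by (cases u)
  have fin: "P (\<Sum>m\<in>A. Poly_Mapping.single m (Poly_Mapping.lookup f m), 0, 0)" if "finite A" for A
    using that
  proof (induction A rule: finite_induct)
    case empty
    show ?case using c[of 0] by simp
  next
    case (insert m A)
    then show ?case
      using add[OF single[of m "Poly_Mapping.lookup f m"] insert.IH] by simp
  qed
  have f: "f = (\<Sum>m\<in>Poly_Mapping.keys f. Poly_Mapping.single m (Poly_Mapping.lookup f m))"
    by (rule poly_mapping_eqI)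
      (auto simp: lookup_sum lookup_single when_def sum.delta not_in_keys_iff_lookup_eq_zero)
  have "P ((f, 0, 0) + ((0, a, 0) + (0, 0, b)))"
    by (intro add c d) (subst f, rule fin, simp)
  then show ?thesis by (simp add: u)
qed

lemma hat_smult_add: "hat_smult G z (u + v) = hat_smult G z u + hat_smult G z v"
  by (cases u; cases v) (simp add: loop_smult_add distrib_left)

lemma hat_bracket_add_left: "hat_bracket G (u + v) w = hat_bracket G u w + hat_bracket G v w"
  by (cases u; cases v; cases w)
    (simp add: loop_bracket_add_left loop_cocycle_add_left loop_smult_add_left loop_smult_add
      loop_deriv_add algebra_simps)

lemma hat_bracket_add_right: "hat_bracket G w (u + v) = hat_bracket G w u + hat_bracket G w v"
  by (cases u; cases v; cases w)
    (simp add: loop_bracket_add_right loop_cocycle_add_right loop_smult_add_left loop_smult_add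
      loop_deriv_add algebra_simps)

lemmas hat_single_simps = loop_bracket_single loop_cocycle_single loop_smult_single
  loop_deriv_single

lemma loop_smult_minus: "loop_smult G z (- f) = - loop_smult G z f"
  by (rule poly_mapping_eqI) (simp add: lookup_loop_smult)

lemma hat_bracket_scale_left: "hat_bracket G (hat_smult G z u) v = hat_smult G z (hat_bracket G u v)"
proof (induction u rule: hat_induct)
  case (single m x)
  show ?case
  proof (induction v rule: hat_induct)
    case (add v w)
    then show ?case by (simp only: hat_smult_add hat_bracket_add_right)
  qed (simp_all add: hat_single_simps br_scale_left form_scale_left loop_smult_loop_smult
      loop_smult_diff loop_smult_minus mult.commute mult.left_commute)
next
  case (add u w)
  then show ?case by (simp only: hat_smult_add hat_bracket_add_left)
next
  case (c a)
  show ?case by (cases v) simp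
next
  case (d b)
  show ?case by (cases v) (simp add: loop_smult_loop_smult)
qed

lemma hat_bracket_swap: "hat_bracket G u v = - hat_bracket G v u"
proof (induction u rule: hat_induct)
  case (add u w)
  then show ?case by (simp add: hat_bracket_add_left hat_bracket_add_right)
next
  case (single m x)
  show ?case
  proof (induction v rule: hat_induct)
    case (add v w)
    then show ?case by (simp add: hat_bracket_add_left hat_bracket_add_right)
  next
    case (single n y)
    have "of_int m = - (of_int n :: complex)" if "m + n = 0"
      using that by (metis add_eq_0_iff2 of_int_minus)
    moreover have "bracket G x y = - bracket G y x" by (rule br_swap)
    ultimately show ?case
      by (auto simp: hat_single_simps add.commute[of n m] form_sym[of y x] single_uminus)
  qed (simp_all add: hat_single_simps)
next
  case (c a)
  show ?case by (cases v) simp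
next
  case (d b)
  show ?case by (cases v) simp
qed

lemma hat_bracket_scale_right: "hat_bracket G u (hat_smult G z v) = hat_smult G z (hat_bracket G u v)"
proof -
  have minus: "hat_smult G z (- w) = - hat_smult G z w" for w
    by (cases w) (simp add: loop_smult_minus)
  have "hat_bracket G u (hat_smult G z v) = - hat_smult G z (hat_bracket G v u)"
    by (subst hat_bracket_swap) (simp only: hat_bracket_scale_left)
  also have "\<dots> = hat_smult G z (hat_bracket G u v)"
    by (subst (2) hat_bracket_swap) (simp only: minus)
  finally show ?thesis .
qed

lemma hat_bracket_self: "hat_bracket G u u = 0"
proof -
  obtain f a b where u: "hat_bracket G u u = (f, a, b)" by (cases "hat_bracket G u u")
  have "(f, a, b) = - (f, a, b)" using hat_bracket_swap[of u u] by (simp add: u)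
  then have "f = - f" and ab: "a = 0" "b = 0" by simp_all
  have "Poly_Mapping.lookup f k = 0" for k
  proof -
    have "Poly_Mapping.lookup f k + Poly_Mapping.lookup f k = 0"
      by (metis \<open>f = - f\<close> add.right_inverse lookup_uminus)
    then have "smult G 2 (Poly_Mapping.lookup f k) = 0"
      using scale_left_distrib[of 1 1 "Poly_Mapping.lookup f k"] by simp
    then show ?thesis by simp
  qed
  then have "f = 0" by (intro poly_mapping_eqI) simp
  with ab u show ?thesis by (simp add: zero_prod_def)
qed

lemma hat_bracket_single_d:
  "hat_bracket G (Poly_Mapping.single m x, a, 0) (0, 0, b)
    = (Poly_Mapping.single m (smult G (- (b * of_int m)) x), 0, 0)"
  "hat_bracket G (0, 0, b) (Poly_Mapping.single m x, a, 0)
    = (Poly_Mapping.single m (smult G (b * of_int m) x), 0, 0)"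
  by (simp_all add: hat_single_simps single_uminus)

lemma hat_bracket_single_single:
  "hat_bracket G (Poly_Mapping.single m x, a, 0) (Poly_Mapping.single n y, a', 0)
    = (Poly_Mapping.single (m + n) (bracket G x y), if m + n = 0 then of_int m * form G x y else 0, 0)"
  by (simp add: hat_single_simps)

lemma hat_jacobi:
  "hat_bracket G u (hat_bracket G v w) + hat_bracket G v (hat_bracket G w u)
    + hat_bracket G w (hat_bracket G u v) = 0" (is "?J u v w = 0")
proof -
  have add1: "?J (u + u') v w = ?J u v w + ?J u' v w" for u u' v w
    by (simp only: hat_bracket_add_left hat_bracket_add_right ac_simps)
  have cyc: "?J u v w = ?J v w u" for u v w
    by (simp only: ac_simps)
  have c0: "hat_bracket G (0, a, 0) v = 0" "hat_bracket G v (0, a, 0) = 0" for a v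
    by (cases v; simp add: zero_prod_def)+
  have zero: "hat_bracket G 0 v = 0" "hat_bracket G v 0 = 0" for v
    using c0[where a = 0 and v = v] by (simp_all add: zero_prod_def)
  have add2: "?J u (v + v') w = ?J u v w + ?J u v' w" for u v v' w
    by (simp only: hat_bracket_add_left hat_bracket_add_right ac_simps)
  have add3: "?J u v (w + w') = ?J u v w + ?J u v w'" for u v w w'
    by (simp only: hat_bracket_add_left hat_bracket_add_right ac_simps)
  have sss: "?J (Poly_Mapping.single m x, 0, 0) (Poly_Mapping.single n y, 0, 0)
      (Poly_Mapping.single k z, 0, 0) = 0" for m n k x y z
  proof -
    let ?c = "form G x (bracket G y z)"
    have form: "form G y (bracket G z x) = ?c" "form G z (bracket G x y) = ?c"
      using form_invariant form_sym by metis+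
    have deg: "n + (k + m) = m + (n + k)" "k + (m + n) = m + (n + k)"
      by simp_all
    have cocycle: "of_int m * ?c + of_int n * ?c + of_int k * ?c = 0" if "m + (n + k) = 0"
    proof -
      have "of_int m * ?c + of_int n * ?c + of_int k * ?c = of_int (m + (n + k)) * ?c"
        by (simp add: distrib_right)
      then show ?thesis by (simp add: that)
    qed
    show ?thesis
      using cocycle
      by (simp add: hat_bracket_single_single deg form zero_prod_def jacobi
          del: hat_bracket.simps flip: single_add)
  qed
  have ssd: "?J (Poly_Mapping.single m x, 0, 0) (Poly_Mapping.single n y, 0, 0) (0, 0, b) = 0"
    for m n x y b
  proof -
    have swap: "bracket G y x = - bracket G x y" by (rule br_swap)
    have cocycle: "of_int m * form G x (smult G (- (b * of_int n)) y)
        + of_int n * form G y (smult G (b * of_int m) x) = 0"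
      by (simp add: form_scale_right form_sym[of y x] del: scale_minus_left)
    have "smult G (- (b * of_int n)) (bracket G x y) + smult G (b * of_int m) (bracket G y x)
        + smult G (b * of_int (m + n)) (bracket G x y) = 0"
      by (simp add: swap algebra_simps)
    then show ?thesis
      using cocycle
      by (simp add: hat_bracket_single_d hat_bracket_single_single br_scale_right zero_prod_def
          add.commute[of n m] del: hat_bracket.simps flip: single_add)
  qed
  have dds: "?J (0, 0, b) (0, 0, b') (Poly_Mapping.single m x, 0, 0) = 0" for m x b b'
  proof -
    have "hat_bracket G (0, 0, b) (0, 0, b') = 0" by (simp add: zero_prod_def)
    moreover have "smult G (b * of_int m) (smult G (b' * of_int m) x)
        + smult G (b' * of_int m) (smult G (- (b * of_int m)) x) = 0"
      by (simp add: ac_simps)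
    ultimately show ?thesis
      by (simp add: hat_bracket_single_d zero zero_prod_def mult.commute
          mult.left_commute del: hat_bracket.simps flip: single_add)
  qed
  have ddd: "?J (0, 0, b) (0, 0, b') (0, 0, b'') = 0" for b b' b''
    by (simp add: zero_prod_def)
  show ?thesis
  proof (induction u arbitrary: v w rule: hat_induct)
    case (add u u') then show ?case by (simp only: add1 add_0_left)
  next
    case (c a) show ?case by (simp only: c0 zero add_0_left)
  next
    case (single m x)
    show ?case
    proof (induction v arbitrary: w rule: hat_induct)
      case (add v v') then show ?case by (simp only: add2 add_0_left)
    next
      case (c a) show ?case by (simp only: c0 zero add_0_left)
    next
      case (single n y)
      show ?case
      proof (induction w rule: hat_induct)
        case (add w w') then show ?case by (simp only: add3 add_0_left)
      next
        case (c a) show ?case by (simp only: c0 zero add_0_left)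
      qed (rule sss ssd)+
    next
      case (d b)
      show ?case
      proof (induction w rule: hat_induct)
        case (add w w') then show ?case by (simp only: add3 add_0_left)
      next
        case (c a) show ?case by (simp only: c0 zero add_0_left)
      next
        case (single n y) show ?case by (subst cyc, subst cyc, rule ssd)
      next
        case (d b') show ?case by (subst cyc, rule dds)
      qed
    qed
  next
    case (d b)
    show ?case
    proof (induction v arbitrary: w rule: hat_induct)
      case (add v v') then show ?case by (simp only: add2 add_0_left)
    next
      case (c a) show ?case by (simp only: c0 zero add_0_left)
    next
      case (single n y)
      show ?case
      proof (induction w rule: hat_induct)
        case (add w w') then show ?case by (simp only: add3 add_0_left)
      next
        case (c a) show ?case by (simp only: c0 zero add_0_left)
      next
        case (single m x) show ?case by (subst cyc, rule ssd)
      next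
        case (d b') show ?case by (subst cyc, subst cyc, rule dds)
      qed
    next
      case (d b')
      show ?case
      proof (induction w rule: hat_induct)
        case (add w w') then show ?case by (simp only: add3 add_0_left)
      next
        case (c a) show ?case by (simp only: c0 zero add_0_left)
      qed (rule dds ddd)+
    qed
  qed
qed

sublocale hat: lie_algebra "hat_smult G" "hat_bracket G"
proof unfold_locales
  fix y z :: complex and u v w :: "'a affine"
  show "hat_smult G z (u + v) = hat_smult G z u + hat_smult G z v"
    by (rule hat_smult_add)
  show "hat_smult G (y + z) u = hat_smult G y u + hat_smult G z u"
    by (cases u) (simp add: loop_smult_add_left distrib_right)
  show "hat_smult G y (hat_smult G z u) = hat_smult G (y * z) u"
    by (cases u) (simp add: loop_smult_loop_smult)
  show "hat_smult G 1 u = u"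
    by (cases u) (simp add: loop_smult_one)
qed (rule hat_bracket_add_left hat_bracket_add_right hat_bracket_scale_left
    hat_bracket_scale_right hat_bracket_self hat_jacobi)+

end

end

theory Submission
  imports Defs
begin

text \<open>
  An ideal is stable under the Cartan subalgebra, so it contains weight vectors. Bracketing one of
  weight \<open>\<alpha> + m\<delta>\<close> with an opposite root vector, in degree 1 for positive and degree 0 for
  negative \<open>\<alpha>\<close>, gives some nonzero \<open>h \<otimes> t^(m+1)\<close> or \<open>h \<otimes> t^m\<close>; hence the inclusion
  from left to right. Conversely, suppose \<open>h \<otimes> t^k\<close> with \<open>h \<noteq> 0\<close> lies in the ideal. Root vectors on
  which \<open>h\<close> acts nontrivially are reached by one bracket with \<open>h \<otimes> t^k\<close>. A root \<open>\<alpha>\<close> with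
  \<open>\<alpha>(h) = 0\<close> is a sum \<open>\<beta> + \<gamma>\<close> of two roots that do not vanish at \<open>h\<close>, with \<open>[g_\<beta>, g_\<gamma>] \<noteq> 0\<close>,
  because the root spaces on which \<open>h\<close> acts nontrivially generate a nonzero ideal of the simple
  algebra; it is reached by two brackets.
\<close>

section \<open>Weights in a Lie algebra\<close>

context lie_algebra
begin

lemma subspace_root_space: "subspace (root_space H \<nu>)"
  by (rule subspaceI)
    (auto simp: root_space_def br_add_right br_scale_right scale_right_distrib mult.commute)

lemma root_space_mem: "x \<in> root_space H \<nu> \<Longrightarrow> h \<in> H \<Longrightarrow> br h x = \<nu> h *s x"
  by (simp add: root_space_def)

lemma br_derivation: "br x (br y z) = br (br x y) z + br y (br x z)"
proof -
  have "br x (br y z) + br y (br z x) + br z (br x y) = 0" by (rule jacobi)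
  moreover have "br z (br x y) = - br (br x y) z" by (rule br_swap)
  moreover have "br y (br z x) = - br y (br x z)" using br_swap[of z x] by simp
  ultimately show ?thesis by (simp add: algebra_simps)
qed

lemma br_root_space:
  assumes "x \<in> root_space H \<nu>" "y \<in> root_space H \<mu>"
  shows "br x y \<in> root_space H (\<nu> + \<mu>)"
  using assms
  by (auto simp: root_space_def br_derivation br_scale_left br_scale_right scale_left_distrib)

lemma dual_space_zero: "0 \<in> dual_space H"
  by (simp add: dual_space_def)

lemma dual_space_add: "\<alpha> \<in> dual_space H \<Longrightarrow> \<beta> \<in> dual_space H \<Longrightarrow> \<alpha> + \<beta> \<in> dual_space H"
  by (auto simp: dual_space_def algebra_simps)

lemma dual_space_minus: "\<alpha> \<in> dual_space H \<Longrightarrow> - \<alpha> \<in> dual_space H"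
  by (auto simp: dual_space_def)

lemma dual_space_eqI:
  assumes "\<alpha> \<in> dual_space H" "\<beta> \<in> dual_space H" "\<And>h. h \<in> H \<Longrightarrow> \<alpha> h = \<beta> h"
  shows "\<alpha> = \<beta>"
proof
  fix x show "\<alpha> x = \<beta> x"
    using assms by (cases "x \<in> H") (auto simp: dual_space_def)
qed

lemma dual_space_nonzero_at:
  assumes "\<nu> \<in> dual_space H" "\<nu> \<noteq> 0"
  obtains h where "h \<in> H" "\<nu> h \<noteq> 0"
  using assms dual_space_eqI[OF assms(1) dual_space_zero] by auto

lemma rootsI: "\<alpha> \<in> dual_space H \<Longrightarrow> \<alpha> \<noteq> 0 \<Longrightarrow> x \<in> root_space H \<alpha> \<Longrightarrow> x \<noteq> 0 \<Longrightarrow> \<alpha> \<in> roots H"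
  by (auto simp: roots_def)

section \<open>Weight vectors in stable subspaces\<close>

text \<open>Induction on the number of weights: either the sum is itself a vector of weight \<mu>,
  or some \<open>h\<close> witnesses that it is not, and then a shorter sum is nonzero and still in
  \<open>U\<close>.\<close>

lemma finite_weight_sum_meets:
  assumes "finite F" and U: "subspace U" "\<And>h u. h \<in> H \<Longrightarrow> u \<in> U \<Longrightarrow> br h u \<in> U"
    and "\<And>\<nu>. \<nu> \<in> F \<Longrightarrow> x \<nu> \<in> root_space H \<nu>"
    and "(\<Sum>\<nu>\<in>F. x \<nu>) \<in> U" "(\<Sum>\<nu>\<in>F. x \<nu>) \<noteq> 0"
  shows "\<exists>\<nu>\<in>F. \<exists>u\<in>U. u \<in> root_space H \<nu> \<and> u \<noteq> 0"
  using assms(1,4-)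
proof (induction F arbitrary: x rule: finite_induct)
  case (insert \<mu> F)
  let ?y = "\<Sum>\<nu>\<in>insert \<mu> F. x \<nu>"
  show ?case
  proof (cases "?y \<in> root_space H \<mu>")
    case False
    then obtain h where h: "h \<in> H" "br h ?y \<noteq> \<mu> h *s ?y" by (auto simp: root_space_def)
    have br_sum: "br h (\<Sum>\<nu>\<in>A. x \<nu>) = (\<Sum>\<nu>\<in>A. br h (x \<nu>))" for A
      by (induction A rule: infinite_finite_induct) (auto simp: br_add_right)
    \<comment> \<open>Applying \<open>ad h - \<mu> h\<close> kills the \<open>\<mu>\<close>-component and stays in \<open>U\<close>.\<close>
    have "br h ?y - \<mu> h *s ?y = (\<Sum>\<nu>\<in>insert \<mu> F. br h (x \<nu>) - \<mu> h *s x \<nu>)"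
      by (simp only: br_sum scale_sum_right sum_subtractf)
    also have "\<dots> = (\<Sum>\<nu>\<in>insert \<mu> F. (\<nu> h - \<mu> h) *s x \<nu>)"
      using insert.prems(1)[THEN root_space_mem, OF _ h(1)]
      by (intro sum.cong) (simp_all add: scale_left_diff_distrib)
    also have "\<dots> = (\<Sum>\<nu>\<in>F. (\<nu> h - \<mu> h) *s x \<nu>)"
      using insert.hyps by simp
    finally have eq: "br h ?y - \<mu> h *s ?y = (\<Sum>\<nu>\<in>F. (\<nu> h - \<mu> h) *s x \<nu>)" .
    have "br h ?y - \<mu> h *s ?y \<in> U"
      using U(1) U(2)[OF h(1) insert.prems(2)] insert.prems(2)
      by (intro subspace_diff subspace_scale)
    moreover have "br h ?y - \<mu> h *s ?y \<noteq> 0" using h(2) by simp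
    ultimately have "\<exists>\<nu>\<in>F. \<exists>u\<in>U. u \<in> root_space H \<nu> \<and> u \<noteq> 0"
      unfolding eq using insert.prems(1)
      by (intro insert.IH[of "\<lambda>\<nu>. (\<nu> h - \<mu> h) *s x \<nu>"])
        (auto intro: subspace_scale[OF subspace_root_space])
    then show ?thesis by blast
  qed (use insert.prems in blast)
qed simp

text \<open>Collects the terms of a linear combination by weight, which is the form of input that
  \<open>finite_weight_sum_meets\<close> takes.\<close>

lemma span_root_spaces_sum:
  assumes "y \<in> span (\<Union>\<nu>\<in>L. root_space H \<nu>)"
  shows "\<exists>F x. finite F \<and> F \<subseteq> L \<and> (\<forall>\<nu>. x \<nu> \<in> root_space H \<nu>) \<and> y = (\<Sum>\<nu>\<in>F. x \<nu>)"
  using assms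
proof (induction rule: span_induct_alt)
  case base
  show ?case
    by (intro exI[of _ "{}"] exI[of _ "\<lambda>_. 0"]) (auto simp: subspace_0[OF subspace_root_space])
next
  case (step c v y)
  from step(2) obtain F x where F: "finite F" "F \<subseteq> L" "\<And>\<nu>. x \<nu> \<in> root_space H \<nu>" "y = (\<Sum>\<nu>\<in>F. x \<nu>)"
    by blast
  from step(1) obtain \<mu> where \<mu>: "\<mu> \<in> L" "v \<in> root_space H \<mu>" by blast
  have sub: "0 \<in> root_space H \<nu>" for \<nu> by (rule subspace_0[OF subspace_root_space])
  \<comment> \<open>The new vector may share its weight with an old summand, so the two are added at
    \<mu>. If \<mu> is not in \<open>F\<close>, the old value of \<open>x\<close> there must not
    contribute and is replaced by 0.\<close>
  let ?x = "\<lambda>\<nu>. (if \<nu> = \<mu> then c *s v else 0) + (if \<nu> \<in> F then x \<nu> else 0)"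
  have "(\<Sum>\<nu>\<in>insert \<mu> F. ?x \<nu>) = c *s v + (\<Sum>\<nu>\<in>insert \<mu> F. if \<nu> \<in> F then x \<nu> else 0)"
    using F(1) by (simp only: sum.distrib) (simp add: sum.delta)
  also have "(\<Sum>\<nu>\<in>insert \<mu> F. if \<nu> \<in> F then x \<nu> else 0) = (\<Sum>\<nu>\<in>F. if \<nu> \<in> F then x \<nu> else 0)"
    using F(1) by (intro sum.mono_neutral_right) auto
  also have "\<dots> = y" using F(4) by simp
  finally have "c *s v + y = (\<Sum>\<nu>\<in>insert \<mu> F. ?x \<nu>)" by simp
  moreover have "?x \<nu> \<in> root_space H \<nu>" for \<nu>
    using F(3) \<mu> sub by (intro subspace_add[OF subspace_root_space])
      (auto intro: subspace_scale[OF subspace_root_space])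
  ultimately show ?case
    using F(1,2) \<mu>(1) by (intro exI[of _ "insert \<mu> F"] exI[of _ ?x]) auto
qed

text \<open>Serves two purposes: with \<open>U\<close> a root space it identifies the weight of that
  space, and with \<open>U\<close> an ideal it supplies a weight vector of the ideal.\<close>

lemma stable_subspace_meets_root_space:
  assumes "subspace U" "\<And>h u. h \<in> H \<Longrightarrow> u \<in> U \<Longrightarrow> br h u \<in> U"
    and "y \<in> span (\<Union>\<nu>\<in>L. root_space H \<nu>)" "y \<in> U" "y \<noteq> 0"
  obtains \<nu> u where "\<nu> \<in> L" "u \<in> U" "u \<in> root_space H \<nu>" "u \<noteq> 0"
proof -
  obtain F x where F: "finite F" "F \<subseteq> L" "\<forall>\<nu>. x \<nu> \<in> root_space H \<nu>" "y = (\<Sum>\<nu>\<in>F. x \<nu>)"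
    using span_root_spaces_sum[OF assms(3)] by blast
  have "\<exists>\<nu>\<in>F. \<exists>u\<in>U. u \<in> root_space H \<nu> \<and> u \<noteq> 0"
    using F(3,4) assms(4,5)
    by (intro finite_weight_sum_meets[of F U H x] assms(1,2) F(1)) auto
  then show ?thesis using F(2) that by blast
qed

lemma root_space_stable:
  assumes "\<And>h h'. h \<in> H \<Longrightarrow> h' \<in> H \<Longrightarrow> br h h' = 0" "h \<in> H" "u \<in> root_space H \<nu>"
  shows "br h u \<in> root_space H \<nu>"
  using assms(2,3) by (simp add: root_space_mem subspace_scale[OF subspace_root_space])

lemma root_space_disjoint:
  assumes "u \<in> root_space H \<nu>" "u \<in> root_space H \<mu>" "u \<noteq> 0"
    and "\<nu> \<in> dual_space H" "\<mu> \<in> dual_space H"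
  shows "\<nu> = \<mu>"
  using assms(4,5)
proof (rule dual_space_eqI)
  fix h assume "h \<in> H"
  then have "\<nu> h *s u = \<mu> h *s u" using assms(1,2) by (metis root_space_mem)
  then show "\<nu> h = \<mu> h" using assms(3) by simp
qed

end

section \<open>Root spaces of the finite-dimensional algebra\<close>

context simple_triangular
begin

abbreviation "\<hh> \<equiv> cartan G"
abbreviation "\<Delta> \<equiv> roots (cartan G)"
abbreviation "\<gg> \<equiv> root_space (cartan G)"

lemma cartan_subspace: "subspace \<hh>"
  using cartan by (simp add: cartan_subalgebra_def toral_def subalgebra_def)

lemma cartan_abelian: "h \<in> \<hh> \<Longrightarrow> h' \<in> \<hh> \<Longrightarrow> bracket G h h' = 0"
  using cartan by (simp add: cartan_subalgebra_def toral_def)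

lemma cartan_le_zero_root_space: "\<hh> \<subseteq> \<gg> 0"
  by (auto simp: root_space_def cartan_abelian)

lemma pos_roots_in_roots: "\<alpha> \<in> pos_roots G \<Longrightarrow> \<alpha> \<in> \<Delta>"
  and neg_roots_in_roots: "\<alpha> \<in> neg_roots G \<Longrightarrow> \<alpha> \<in> \<Delta>"
  using roots_eq by auto

lemma uminus_mem_neg_roots: "\<alpha> \<in> pos_roots G \<Longrightarrow> - \<alpha> \<in> neg_roots G"
  by (simp add: neg_roots_def)

lemma uminus_mem_pos_roots: "\<alpha> \<in> neg_roots G \<Longrightarrow> - \<alpha> \<in> pos_roots G"
  by (auto simp: neg_roots_def)

lemma uminus_mem_roots: "\<alpha> \<in> \<Delta> \<Longrightarrow> - \<alpha> \<in> \<Delta>"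
  using roots_eq uminus_mem_neg_roots uminus_mem_pos_roots by auto

lemma roots_dual: "\<alpha> \<in> insert 0 \<Delta> \<Longrightarrow> \<alpha> \<in> dual_space \<hh>"
  using dual_space_zero by (auto simp: roots_def)

lemma decompose_UNIV:
  obtains h x where "h \<in> \<hh>" "x \<in> span (\<Union>\<alpha>\<in>\<Delta>. \<gg> \<alpha>)" "y = h + x"
proof -
  obtain n h p where nhp: "n \<in> n_minus G" "h \<in> \<hh>" "p \<in> n_plus G" "y = n + h + p"
    using bij_betw_imp_surj_on[OF triangular] by (auto simp: image_def set_eq_iff dest: spec[of _ y])
  have "n_minus G \<subseteq> span (\<Union>\<alpha>\<in>\<Delta>. \<gg> \<alpha>)" "n_plus G \<subseteq> span (\<Union>\<alpha>\<in>\<Delta>. \<gg> \<alpha>)"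
    unfolding n_minus_def n_plus_def using roots_eq by (intro span_mono; auto)+
  then have "n + p \<in> span (\<Union>\<alpha>\<in>\<Delta>. \<gg> \<alpha>)"
    using nhp by (intro span_add) auto
  then show ?thesis using that[of h "n + p"] nhp by (simp add: ac_simps)
qed

lemma mem_span_root_spaces: "y \<in> span (\<Union>\<nu>\<in>insert 0 \<Delta>. \<gg> \<nu>)"
proof -
  obtain h x where hx: "h \<in> \<hh>" "x \<in> span (\<Union>\<alpha>\<in>\<Delta>. \<gg> \<alpha>)" "y = h + x" by (rule decompose_UNIV)
  have "x \<in> span (\<Union>\<nu>\<in>insert 0 \<Delta>. \<gg> \<nu>)"
    using hx(2) span_mono[of "\<Union>\<alpha>\<in>\<Delta>. \<gg> \<alpha>" "\<Union>\<nu>\<in>insert 0 \<Delta>. \<gg> \<nu>"] by auto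
  moreover have "h \<in> span (\<Union>\<nu>\<in>insert 0 \<Delta>. \<gg> \<nu>)"
    using hx(1) cartan_le_zero_root_space by (intro span_base) auto
  ultimately show ?thesis using hx(3) by (simp add: span_add)
qed

text \<open>Once its Cartan component is subtracted, a vector of weight 0 lies in the span of the
  root spaces. If it were nonzero, some root would have to equal 0.\<close>

lemma zero_root_space: "\<gg> 0 = \<hh>"
proof (intro antisym cartan_le_zero_root_space subsetI)
  fix y assume y: "y \<in> \<gg> 0"
  obtain h x where hx: "h \<in> \<hh>" "x \<in> span (\<Union>\<alpha>\<in>\<Delta>. \<gg> \<alpha>)" "y = h + x" by (rule decompose_UNIV)
  have x: "x \<in> \<gg> 0"
    using subspace_diff[OF subspace_root_space y, of h] hx cartan_le_zero_root_space by auto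
  have "x = 0"
  proof (rule ccontr)
    assume "x \<noteq> 0"
    then obtain \<alpha> u where "\<alpha> \<in> \<Delta>" "u \<in> \<gg> 0" "u \<in> \<gg> \<alpha>" "u \<noteq> 0"
      using stable_subspace_meets_root_space[OF subspace_root_space
          root_space_stable[OF cartan_abelian] hx(2) x]
      by blast
    then have "\<alpha> = 0" using root_space_disjoint[of u \<hh> \<alpha> 0] roots_dual by blast
    then show False using \<open>\<alpha> \<in> \<Delta>\<close> by (simp add: roots_def)
  qed
  then show "y \<in> \<hh>" using hx by simp
qed

section \<open>Opposite root vectors through the invariant form\<close>

lemma form_span_nonzero:
  assumes "w \<in> span S" "form G x w \<noteq> 0"
  obtains s where "s \<in> S" "form G x s \<noteq> 0"
proof -
  have "\<exists>s\<in>S. form G x s \<noteq> 0"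
  proof (rule ccontr)
    assume *: "\<not> ?thesis"
    have "form G x w = 0"
      using assms(1) by (induction rule: span_induct_alt) (use * in \<open>auto simp: form_add_right form_scale_right\<close>)
    then show False using assms(2) by simp
  qed
  then show ?thesis using that by blast
qed

text \<open>Moving \<open>h\<close> across the form by invariance gives
  \<open>(\<nu> h + \<mu> h) * form G x y = 0\<close>.\<close>

lemma form_nonzero_weights:
  assumes "x \<in> \<gg> \<nu>" "y \<in> \<gg> \<mu>" "form G x y \<noteq> 0" "\<nu> \<in> dual_space \<hh>" "\<mu> \<in> dual_space \<hh>"
  shows "\<mu> = - \<nu>"
proof (rule dual_space_eqI[OF assms(5) dual_space_minus[OF assms(4)]])
  fix h assume h: "h \<in> \<hh>"
  have "\<nu> h * form G x y = form G (bracket G h x) y"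
    using h assms(1) by (simp add: root_space_mem form_scale_left)
  also have "\<dots> = - form G (bracket G x h) y"
    by (subst br_swap) (metis add.right_inverse br_add_left form_add_left form_zero_left add_eq_0_iff2 minus_unique)
  also have "\<dots> = - (\<mu> h * form G x y)"
    using h assms(2) by (simp add: form_invariant root_space_mem form_scale_right)
  finally have "(\<nu> h + \<mu> h) * form G x y = 0" by (simp add: distrib_right)
  then show "\<mu> h = (- \<nu>) h" using assms(3) by (simp add: eq_neg_iff_add_eq_0 add.commute)
qed

text \<open>Nondegeneracy gives a weight vector \<open>y\<close> that pairs nontrivially with
  \<open>x\<close>, and its weight can only be -\<alpha>. The bracket is nonzero because pairing it
  with an \<open>h\<close> where \<alpha> does not vanish yields
  \<open>\<alpha> h * form G x y\<close>.\<close>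

lemma opposite_root_vector:
  assumes "\<alpha> \<in> \<Delta>" "x \<in> \<gg> \<alpha>" "x \<noteq> 0"
  obtains y where "y \<in> \<gg> (- \<alpha>)" "bracket G x y \<in> \<hh>" "bracket G x y \<noteq> 0"
proof -
  obtain w where w: "form G x w \<noteq> 0" using form_nondegenerate assms(3) by blast
  obtain \<nu> y where y: "\<nu> \<in> insert 0 \<Delta>" "y \<in> \<gg> \<nu>" "form G x y \<noteq> 0"
    using form_span_nonzero[OF mem_span_root_spaces w] by blast
  have "\<nu> = - \<alpha>"
    using form_nonzero_weights[OF assms(2) y(2,3) roots_dual roots_dual[OF y(1)]] assms(1) by simp
  obtain h where h: "h \<in> \<hh>" "\<alpha> h \<noteq> 0"
    using assms(1) dual_space_nonzero_at by (auto simp: roots_def)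
  have "form G h (bracket G x y) = \<alpha> h * form G x y"
    using h assms(2) by (simp add: root_space_mem form_scale_left flip: form_invariant)
  then have "bracket G x y \<noteq> 0" using h(2) y(3) by auto
  moreover have "bracket G x y \<in> \<hh>"
    using br_root_space[OF assms(2) y(2)] \<open>\<nu> = - \<alpha>\<close> by (simp add: zero_root_space)
  ultimately show ?thesis using that y(2) \<open>\<nu> = - \<alpha>\<close> by metis
qed

section \<open>Consequences of simplicity for the roots\<close>

text \<open>The center is an ideal, and it is not everything because some bracket is
  nonzero.\<close>

lemma center_trivial:
  assumes "\<And>x. bracket G h x = 0"
  shows "h = 0"
proof -
  let ?Z = "{z. \<forall>x. bracket G z x = 0}"
  have "bracket G x z = 0" if "z \<in> ?Z" for x z
    using that br_swap[of x z] by simp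
  then have "ideal_of UNIV ?Z"
    by (auto simp: ideal_of_def br_add_left br_scale_left intro!: subspaceI)
  moreover have "?Z \<noteq> UNIV" using simple by (auto simp: simple_lie_algebra_def)
  ultimately have "?Z = {0}" using simple by (auto simp: simple_lie_algebra_def)
  then show ?thesis using assms by auto
qed

text \<open>If all roots vanished at \<open>h\<close>, then \<open>h\<close> would commute with
  every root space and with \<hh>, hence be central. A negative root is exchanged for its
  opposite.\<close>

lemma pos_root_nonzero_at:
  assumes "h \<in> \<hh>" "h \<noteq> 0"
  obtains \<alpha> where "\<alpha> \<in> pos_roots G" "\<alpha> h \<noteq> 0"
proof -
  have "\<exists>\<alpha>\<in>\<Delta>. \<alpha> h \<noteq> 0"
  proof (rule ccontr)
    assume *: "\<not> ?thesis"
    have "bracket G h x = 0" for x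
    proof -
      have "x \<in> span (\<Union>\<nu>\<in>insert 0 \<Delta>. \<gg> \<nu>)" by (rule mem_span_root_spaces)
      then show ?thesis
        by (induction rule: span_induct_alt)
          (use * assms in \<open>auto simp: br_add_right br_scale_right root_space_mem\<close>)
    qed
    then show False using center_trivial assms by blast
  qed
  then obtain \<alpha> where \<alpha>: "\<alpha> \<in> \<Delta>" "\<alpha> h \<noteq> 0" by blast
  show ?thesis
  proof (cases "\<alpha> \<in> pos_roots G")
    case True
    then show ?thesis using \<alpha>(2) that by blast
  next
    case False
    then have "- \<alpha> \<in> pos_roots G" using \<alpha>(1) roots_eq uminus_mem_pos_roots by blast
    then show ?thesis using \<alpha>(2) that[of "- \<alpha>"] by simp
  qed
qed

text \<open>
  The root spaces \<open>W\<close> on which \<open>h\<close> acts nontrivially span, together with \<open>[W, W]\<close>, a nonzero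
  ideal, hence everything.
\<close>

lemma root_as_sum_nonzero_at:
  assumes h: "h \<in> \<hh>" "h \<noteq> 0" and \<alpha>: "\<alpha> \<in> \<Delta>" "\<alpha> h = 0"
  obtains \<beta> \<gamma> y z where "\<beta> \<in> \<Delta>" "\<gamma> \<in> \<Delta>" "\<beta> h \<noteq> 0" "\<gamma> h \<noteq> 0" "\<alpha> = \<beta> + \<gamma>"
    "y \<in> \<gg> \<beta>" "z \<in> \<gg> \<gamma>" "bracket G y z \<noteq> 0"
proof -
  \<comment> \<open>The weights in \<open>W\<close> are arbitrary functionals, so the closure steps
    need not show that a sum of weights is a root. At the end, nonzero vectors turn them into
    roots.\<close>
  define W where "W = {y. \<exists>\<beta>. \<beta> \<in> dual_space \<hh> \<and> \<beta> h \<noteq> 0 \<and> y \<in> \<gg> \<beta>}"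
  define S where "S = W \<union> {bracket G y z | y z. y \<in> W \<and> z \<in> W}"
  have W_closed: "bracket G x y \<in> W" if x: "x \<in> \<gg> \<nu>" "\<nu> \<in> dual_space \<hh>" "\<nu> h = 0" and y: "y \<in> W" for x y \<nu>
  proof -
    obtain \<beta> where \<beta>: "\<beta> \<in> dual_space \<hh>" "\<beta> h \<noteq> 0" "y \<in> \<gg> \<beta>" using y by (auto simp: W_def)
    then have "bracket G x y \<in> \<gg> (\<nu> + \<beta>)" "\<nu> + \<beta> \<in> dual_space \<hh>" "(\<nu> + \<beta>) h \<noteq> 0"
      using x by (auto intro: br_root_space dual_space_add)
    then show ?thesis unfolding W_def by blast
  qed
  \<comment> \<open>If \<nu> vanishes at \<open>h\<close>, then \<open>ad x\<close> preserves
    \<open>W\<close> and acts on brackets of elements of \<open>W\<close> as a derivation. Otherwise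
    \<open>x\<close> itself lies in \<open>W\<close>.\<close>
  have gen: "bracket G x s \<in> span S" if x: "x \<in> \<gg> \<nu>" "\<nu> \<in> dual_space \<hh>" and s: "s \<in> S" for x s \<nu>
  proof (cases "\<nu> h = 0")
    case True
    have "bracket G x s \<in> span S" if "s \<in> W"
      using W_closed[OF x True that] by (intro span_base) (simp add: S_def)
    moreover have "bracket G x s \<in> span S" if "s = bracket G y z" "y \<in> W" "z \<in> W" for y z
    proof -
      have "bracket G (bracket G x y) z \<in> S" "bracket G y (bracket G x z) \<in> S"
        using W_closed[OF x True] that by (auto simp: S_def)
      then show ?thesis unfolding that(1) br_derivation[of x y z] by (intro span_add span_base)
    qed
    ultimately show ?thesis using s by (auto simp: S_def)
  next
    case False
    then have "x \<in> W" using x by (auto simp: W_def)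
    then have *: "bracket G x s \<in> span S" if "s \<in> W"
      using that by (intro span_base) (auto simp: S_def)
    have "bracket G x s \<in> span S" if yz: "s = bracket G y z" "y \<in> W" "z \<in> W" for y z
    proof -
      obtain \<beta> \<gamma> where \<beta>\<gamma>: "\<beta> \<in> dual_space \<hh>" "y \<in> \<gg> \<beta>" "\<gamma> \<in> dual_space \<hh>" "z \<in> \<gg> \<gamma>"
        using yz by (auto simp: W_def)
      then have s': "s \<in> \<gg> (\<beta> + \<gamma>)" "\<beta> + \<gamma> \<in> dual_space \<hh>"
        using yz by (auto intro: br_root_space dual_space_add)
      show ?thesis
      \<comment> \<open>If the weight of \<open>s\<close> vanishes at \<open>h\<close>, bracketing
        \<open>s\<close> with \<open>x\<close> stays in \<open>W\<close>; if not, \<open>s\<close>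
        is already in \<open>W\<close>.\<close>
      proof (cases "(\<beta> + \<gamma>) h = 0")
        case True
        then have "bracket G s x \<in> W" using W_closed[OF s' True \<open>x \<in> W\<close>] by simp
        then have "bracket G s x \<in> span S" by (intro span_base) (simp add: S_def)
        then show ?thesis using br_swap[of x s] span_neg by simp
      next
        case False
        then have "s \<in> W" using s' unfolding W_def by blast
        then show ?thesis by (rule *)
      qed
    qed
    then show ?thesis using s * by (auto simp: S_def)
  qed
  have ideal: "bracket G x k \<in> span S" if "k \<in> span S" for x k
  proof -
    have "bracket G x s \<in> span S" if "s \<in> S" for s
    proof -
      have "x \<in> span (\<Union>\<nu>\<in>insert 0 \<Delta>. \<gg> \<nu>)" by (rule mem_span_root_spaces)
      then show ?thesis
      proof (induction rule: span_induct_alt)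
        case base then show ?case by (simp add: span_zero)
      next
        case (step c v x)
        then obtain \<nu> where "\<nu> \<in> insert 0 \<Delta>" "v \<in> \<gg> \<nu>" by blast
        then have "bracket G v s \<in> span S" using gen roots_dual that by blast
        then show ?case using step by (simp add: br_add_left br_scale_left span_add span_scale)
      qed
    qed
    with that show ?thesis
    proof (induction rule: span_induct_alt)
      case (step c s y)
      then show ?case by (simp add: br_add_right br_scale_right span_add span_scale)
    qed (simp add: span_zero)
  qed
  obtain \<beta>0 where \<beta>0: "\<beta>0 \<in> pos_roots G" "\<beta>0 h \<noteq> 0" using pos_root_nonzero_at[OF h] by blast
  then obtain e where "e \<in> \<gg> \<beta>0" "e \<noteq> 0"
    using pos_roots_in_roots subspace_0[OF subspace_root_space] by (force simp: roots_def)
  moreover have "e \<in> span S" using \<open>e \<in> \<gg> \<beta>0\<close> \<beta>0 roots_dual pos_roots_in_roots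
    by (intro span_base) (auto simp: S_def W_def)
  ultimately have "span S \<noteq> {0}" by auto
  moreover have "ideal_of UNIV (span S)" using ideal by (simp add: ideal_of_def)
  ultimately have full: "span S = UNIV" using simple by (auto simp: simple_lie_algebra_def)
  \<comment> \<open>A vector of weight -\<alpha> pairs nontrivially with some \<open>s\<close> in
    \<open>S\<close>. Any weight of \<open>s\<close> must be \<alpha>, which vanishes at
    \<open>h\<close>, so \<open>s\<close> is not in \<open>W\<close> and has to be a
    bracket.\<close>
  have "- \<alpha> \<in> \<Delta>" using \<alpha> uminus_mem_roots by blast
  then obtain x where x: "x \<in> \<gg> (- \<alpha>)" "x \<noteq> 0"
    using subspace_0[OF subspace_root_space] by (force simp: roots_def)
  obtain w where "form G x w \<noteq> 0" using form_nondegenerate x(2) by blast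
  then obtain s where s: "s \<in> S" "form G x s \<noteq> 0" using form_span_nonzero full by blast
  have weight: "\<mu> = \<alpha>" if "s \<in> \<gg> \<mu>" "\<mu> \<in> dual_space \<hh>" for \<mu>
    using form_nonzero_weights[OF x(1) that(1) s(2)] that(2) \<open>- \<alpha> \<in> \<Delta>\<close> roots_dual by simp
  then have "s \<notin> W" using \<alpha>(2) by (auto simp: W_def)
  then obtain y z where yz: "s = bracket G y z" "y \<in> W" "z \<in> W" using s by (auto simp: S_def)
  then obtain \<beta> \<gamma> where \<beta>\<gamma>: "\<beta> \<in> dual_space \<hh>" "y \<in> \<gg> \<beta>" "\<beta> h \<noteq> 0" "\<gamma> \<in> dual_space \<hh>" "z \<in> \<gg> \<gamma>" "\<gamma> h \<noteq> 0"
    by (auto simp: W_def)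
  then have "\<alpha> = \<beta> + \<gamma>" using weight[of "\<beta> + \<gamma>"] yz by (auto intro: br_root_space dual_space_add)
  moreover have "y \<noteq> 0" "z \<noteq> 0" "bracket G y z \<noteq> 0" using s yz by auto
  moreover from this have "\<beta> \<in> \<Delta>" "\<gamma> \<in> \<Delta>" using \<beta>\<gamma> by (auto intro!: rootsI)
  ultimately show ?thesis using that \<beta>\<gamma> by blast
qed

text \<open>Otherwise -\<beta> and -\<gamma> are positive, and their sum would be a positive and a
  negative root at once.\<close>

lemma pos_root_summand:
  assumes "\<beta> \<in> \<Delta>" "\<gamma> \<in> \<Delta>" "\<beta> + \<gamma> \<in> pos_roots G"
  shows "\<beta> \<in> pos_roots G \<or> \<gamma> \<in> pos_roots G"
proof (rule ccontr)
  assume "\<not> ?thesis"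
  then have "- \<beta> \<in> pos_roots G" "- \<gamma> \<in> pos_roots G" using assms roots_eq uminus_mem_pos_roots by auto
  moreover have "- (\<beta> + \<gamma>) \<in> neg_roots G" using assms(3) by (rule uminus_mem_neg_roots)
  then have "- \<beta> + - \<gamma> \<in> neg_roots G" by (simp add: minus_add_distrib)
  ultimately show False using pos_roots_closed pos_neg_disjoint neg_roots_in_roots by blast
qed

section \<open>Affine weights\<close>

abbreviation affine_weight :: "('a \<Rightarrow> complex) \<Rightarrow> int \<Rightarrow> 'a affine \<Rightarrow> complex" where
  "affine_weight \<nu> m \<equiv> lift G \<nu> + mult_delta G m"

text \<open>Index pairs for the weights occurring in \<open>hat_n_plus G\<close>. Taking \<nu> = 0
  encodes the imaginary roots, so that real and imaginary roots are handled together.\<close>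

definition affine_indices :: "(('a \<Rightarrow> complex) \<times> int) set" where
  "affine_indices = pos_roots G \<times> {0} \<union> insert 0 \<Delta> \<times> {0<..}"

lemma affine_weight_zero: "affine_weight 0 m = mult_delta G m"
  by (rule ext) (simp add: lift_def)

lemma mult_delta_add: "mult_delta G m + mult_delta G n = mult_delta G (m + n)"
  by (rule ext) (simp add: mult_delta_def distrib_right)

lemma hat_cartanE:
  assumes "x \<in> hat_cartan G"
  obtains h a b where "h \<in> \<hh>" "x = (Poly_Mapping.single 0 h, a, b)"
  using assms by (auto simp: hat_cartan_def)

lemma hat_cartanI: "h \<in> \<hh> \<Longrightarrow> (Poly_Mapping.single 0 h, a, b) \<in> hat_cartan G"
  by (auto simp: hat_cartan_def)

lemma hat_cartan_abelian:
  assumes "x \<in> hat_cartan G" "y \<in> hat_cartan G"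
  shows "hat_bracket G x y = 0"
  using assms by (auto elim!: hat_cartanE simp: hat_single_simps cartan_abelian zero_prod_def)

lemma affine_weight_eval:
  "h \<in> \<hh> \<Longrightarrow> affine_weight \<nu> m (Poly_Mapping.single 0 h, a, b) = \<nu> h + of_int m * b"
  by (simp add: lift_def mult_delta_def hat_cartanI)

lemma affine_weight_dual:
  assumes "\<nu> \<in> dual_space \<hh>"
  shows "affine_weight \<nu> m \<in> hat.dual_space (hat_cartan G)"
proof -
  have "affine_weight \<nu> m (x + y) = affine_weight \<nu> m x + affine_weight \<nu> m y"
    if xy: "x \<in> hat_cartan G" "y \<in> hat_cartan G" for x y
  proof -
    obtain h a b h' a' b' where *: "h \<in> \<hh>" "x = (Poly_Mapping.single 0 h, a, b)"
      "h' \<in> \<hh>" "y = (Poly_Mapping.single 0 h', a', b')"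
      using xy by (auto elim!: hat_cartanE)
    moreover have "h + h' \<in> \<hh>" using * subspace_add[OF cartan_subspace] by blast
    moreover have "\<nu> (h + h') = \<nu> h + \<nu> h'" using assms * by (simp add: dual_space_def)
    ultimately show ?thesis
      by (simp add: affine_weight_eval distrib_left del: plus_fun_apply flip: single_add)
  qed
  moreover have "affine_weight \<nu> m (hat_smult G c x) = c * affine_weight \<nu> m x"
    if x: "x \<in> hat_cartan G" for c x
  proof -
    obtain h a b where *: "h \<in> \<hh>" "x = (Poly_Mapping.single 0 h, a, b)"
      using x by (auto elim!: hat_cartanE)
    moreover have "smult G c h \<in> \<hh>" using * subspace_scale[OF cartan_subspace] by blast
    moreover have "\<nu> (smult G c h) = c * \<nu> h" using assms * by (simp add: dual_space_def)
    ultimately show ?thesis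
      by (simp add: affine_weight_eval loop_smult_single distrib_left mult.left_commute
          del: plus_fun_apply)
  qed
  moreover have "affine_weight \<nu> m x = 0" if "x \<notin> hat_cartan G" for x
    using that by (simp add: lift_def mult_delta_def)
  ultimately show ?thesis by (simp add: hat.dual_space_def del: plus_fun_apply)
qed

text \<open>Evaluation on \<hh> recovers \<nu>, and evaluation at \<open>d\<close> then recovers
  \<open>m\<close>.\<close>

lemma affine_weight_nonzero:
  assumes "\<nu> \<in> dual_space \<hh>" "\<nu> \<noteq> 0 \<or> m \<noteq> 0"
  shows "affine_weight \<nu> m \<noteq> 0"
proof
  assume *: "affine_weight \<nu> m = 0"
  have ev: "\<nu> h + of_int m * b = 0" if "h \<in> \<hh>" for h b
    using affine_weight_eval[OF that, of \<nu> m 0 b] * by simp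
  then have "\<nu> h = 0" if "h \<in> \<hh>" for h using that ev[of h 0] by simp
  then have "\<nu> = 0" using dual_space_nonzero_at[OF assms(1)] by blast
  moreover from this have "m = 0" using ev[of 0 1] subspace_0[OF cartan_subspace] by simp
  ultimately show False using assms(2) by simp
qed

section \<open>Root spaces and positive roots of the affine algebra\<close>

lemma tensor_t_eq_zero_iff [simp]: "tensor_t x k = 0 \<longleftrightarrow> x = 0"
  by (metis lookup_single_eq lookup_zero prod.inject single_zero tensor_t_def zero_prod_def)

lemma tensor_t_add: "tensor_t (x + y) k = tensor_t x k + tensor_t y k"
  by (simp add: tensor_t_def single_add)

lemma tensor_t_smult: "tensor_t (smult G c x) k = hat_smult G c (tensor_t x k)"
  by (simp add: tensor_t_def loop_smult_single)

lemma tensor_t_mem_root_space: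
  assumes "y \<in> \<gg> \<nu>"
  shows "tensor_t y m \<in> hat_root_space G (affine_weight \<nu> m)"
proof -
  have "hat_bracket G x (tensor_t y m) = hat_smult G (affine_weight \<nu> m x) (tensor_t y m)"
    if x: "x \<in> hat_cartan G" for x
  proof -
    obtain h a b where *: "h \<in> \<hh>" "x = (Poly_Mapping.single 0 h, a, b)"
      using x by (auto elim!: hat_cartanE)
    have "smult G (of_int m * b) y = smult G b (smult G (of_int m) y)" by (simp add: mult.commute)
    then show ?thesis
      using * assms
      by (simp add: affine_weight_eval tensor_t_def hat_single_simps root_space_mem
          scale_left_distrib single_add mult.commute del: plus_fun_apply)
  qed
  then show ?thesis by (simp add: hat_root_space_def hat.root_space_def)
qed

text \<open>The action of \<open>d\<close> singles out the degree and that of \<hh> the finite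
  weight. The zero weight is excluded because its root space is all of \<open>hat_cartan G\<close>,
  including \<open>c\<close> and \<open>d\<close>.\<close>

lemma hat_root_spaceE:
  assumes z: "z \<in> hat_root_space G (affine_weight \<nu> m)"
    and \<nu>: "\<nu> \<in> dual_space \<hh>" "\<nu> \<noteq> 0 \<or> m \<noteq> 0"
  obtains y where "y \<in> \<gg> \<nu>" "z = tensor_t y m"
proof -
  obtain f a b where fab: "z = (f, a, b)" by (cases z)
  have br: "hat_bracket G (Poly_Mapping.single 0 h, a', b') z = hat_smult G (\<nu> h + of_int m * b') z"
    if "h \<in> \<hh>" for h a' b'
    using z hat_cartanI[OF that] affine_weight_eval[OF that]
    by (metis hat_root_space_def hat.root_space_mem)
  have \<nu>0: "\<nu> 0 = 0" using \<nu>(1) subspace_0[OF cartan_subspace]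
    unfolding dual_space_def by (metis (mono_tags, lifting) mem_Collect_eq mult_zero_left scale_zero_left)
  \<comment> \<open>This is \<open>br\<close> at the element \<open>d\<close>, that is at
    \<open>(0, 0, 1)\<close>.\<close>
  have d: "loop_deriv G f = loop_smult G (of_int m) f" "of_int m * a = 0" "of_int m * b = 0"
    using br[OF subspace_0[OF cartan_subspace], of 0 1]
    by (auto simp: fab loop_smult_one \<nu>0 loop_bracket_def loop_cocycle_def loop_deriv_def)
  have "Poly_Mapping.lookup f k = 0" if "k \<noteq> m" for k
  proof -
    have "smult G (of_int k) (Poly_Mapping.lookup f k) = smult G (of_int m) (Poly_Mapping.lookup f k)"
      using d(1) by (metis lookup_loop_deriv lookup_loop_smult)
    then show ?thesis using that by simp
  qed
  then have f: "f = Poly_Mapping.single m (Poly_Mapping.lookup f m)" (is "_ = Poly_Mapping.single m ?y")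
    by (intro poly_mapping_eqI) (auto simp: lookup_single when_def)
  \<comment> \<open>For nonzero \<open>m\<close> the action of \<open>d\<close> already kills both
    coordinates; for \<open>m = 0\<close> an \<open>h\<close> with nonzero \<open>\<nu> h\<close>
    does so.\<close>
  have ab: "a = 0 \<and> b = 0"
  proof (cases "m = 0")
    case True
    then obtain h where h: "h \<in> \<hh>" "\<nu> h \<noteq> 0" using dual_space_nonzero_at \<nu> by blast
    have "\<nu> h * a = 0 \<and> \<nu> h * b = 0"
      using br[OF h(1), of 0 0] by (subst (asm) fab, subst (asm) f) (simp add: fab True hat_single_simps)
    then show ?thesis using h(2) by simp
  qed (use d in auto)
  have "bracket G h ?y = smult G (\<nu> h) ?y" if "h \<in> \<hh>" for h
  proof -
    have "Poly_Mapping.single m (bracket G h ?y) = Poly_Mapping.single m (smult G (\<nu> h) ?y)"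
      using br[OF that, of 0 0] ab unfolding fab by (subst (asm) (1 2) f) (simp add: hat_single_simps)
    then show ?thesis by (metis lookup_single_eq)
  qed
  then have "?y \<in> \<gg> \<nu>" by (simp add: root_space_def)
  then show ?thesis using that f ab fab by (metis tensor_t_def)
qed

lemma tensor_t_mem_span:
  assumes "x \<in> span (\<Union>\<nu>\<in>L. \<gg> \<nu>)" "\<And>\<nu>. \<nu> \<in> L \<Longrightarrow> (\<nu>, m) \<in> M"
  shows "tensor_t x m \<in> hat.span (\<Union>\<mu>\<in>case_prod affine_weight ` M. hat_root_space G \<mu>)"
  using assms(1)
proof (induction rule: span_induct_alt)
  case base
  then show ?case by (simp add: tensor_t_def hat.span_zero flip: zero_prod_def)
next
  case (step c v y)
  then obtain \<nu> where "\<nu> \<in> L" "v \<in> \<gg> \<nu>" by blast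
  then have "tensor_t v m \<in> (\<Union>\<mu>\<in>case_prod affine_weight ` M. hat_root_space G \<mu>)"
    using assms(2) tensor_t_mem_root_space by force
  then show ?case
    unfolding tensor_t_add tensor_t_smult
    using step.IH by (intro hat.span_add hat.span_scale) (rule hat.span_base)
qed

lemma hat_n_plus_span:
  "hat_n_plus G \<subseteq> hat.span (\<Union>\<mu>\<in>case_prod affine_weight ` affine_indices. hat_root_space G \<mu>)"
  unfolding hat_n_plus_def
proof (rule hat.span_minimal)
  show "{tensor_t x 0 |x. x \<in> n_plus G} \<union> {tensor_t x k |x k. 0 < k}
    \<subseteq> hat.span (\<Union>\<mu>\<in>case_prod affine_weight ` affine_indices. hat_root_space G \<mu>)"
    using tensor_t_mem_span[of _ "pos_roots G" 0 affine_indices]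
      tensor_t_mem_span[OF mem_span_root_spaces, of _ affine_indices]
    by (auto simp: n_plus_def affine_indices_def simp del: UN_insert UN_simps)
qed (rule hat.subspace_span)

lemma stable_meets_affine_weight:
  assumes "hat.subspace U" "\<And>h u. h \<in> hat_cartan G \<Longrightarrow> u \<in> U \<Longrightarrow> hat_bracket G h u \<in> U"
    and "x \<in> hat_n_plus G" "x \<in> U" "x \<noteq> 0"
  obtains \<nu> m u where "(\<nu>, m) \<in> affine_indices" "u \<in> U"
    "u \<in> hat_root_space G (affine_weight \<nu> m)" "u \<noteq> 0"
proof -
  have span: "x \<in> hat.span (\<Union>\<mu>\<in>case_prod affine_weight ` affine_indices. hat.root_space (hat_cartan G) \<mu>)"
    using subsetD[OF hat_n_plus_span assms(3)] by (simp only: hat_root_space_def)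
  obtain \<mu> u where u: "\<mu> \<in> case_prod affine_weight ` affine_indices" "u \<in> U"
    "u \<in> hat.root_space (hat_cartan G) \<mu>" "u \<noteq> 0"
    by (rule hat.stable_subspace_meets_root_space[OF assms(1,2) span assms(4,5)])
  from u(1) obtain \<nu> m where "(\<nu>, m) \<in> affine_indices" "\<mu> = affine_weight \<nu> m" by auto
  then show ?thesis using that u(2-4) unfolding hat_root_space_def by blast
qed

lemma affine_indices_dual: "(\<nu>, m) \<in> affine_indices \<Longrightarrow> \<nu> \<in> insert 0 \<Delta>"
  using roots_eq by (auto simp: affine_indices_def)

lemma affine_indices_nonzero: "(\<nu>, m) \<in> affine_indices \<Longrightarrow> \<nu> \<noteq> 0 \<or> m \<noteq> 0"
  using pos_roots_in_roots by (auto simp: affine_indices_def roots_def)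

text \<open>The root space of \<mu> is stable under the Cartan subalgebra, so it shares a nonzero
  vector with the root space of an indexed weight; functionals with a common nonzero weight vector
  agree.\<close>

lemma hat_pos_rootE:
  assumes "\<mu> \<in> hat_pos_roots G"
  obtains \<nu> m where "(\<nu>, m) \<in> affine_indices" "\<mu> = affine_weight \<nu> m"
proof -
  have \<mu>: "\<mu> \<in> hat.dual_space (hat_cartan G)" "hat_n_plus G \<inter> hat_root_space G \<mu> \<noteq> {0}"
    using assms by (auto simp: hat_pos_roots_def hat.roots_def)
  have "0 \<in> hat_n_plus G \<inter> hat_root_space G \<mu>"
    by (simp add: hat_n_plus_def hat.span_zero hat_root_space_def hat.subspace_0[OF hat.subspace_root_space])
  then obtain x where x: "x \<in> hat_n_plus G" "x \<in> hat_root_space G \<mu>" "x \<noteq> 0" using \<mu>(2) by blast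
  then obtain \<nu> m u where u: "(\<nu>, m) \<in> affine_indices" "u \<in> hat_root_space G \<mu>"
    "u \<in> hat_root_space G (affine_weight \<nu> m)" "u \<noteq> 0"
    using stable_meets_affine_weight[of "hat_root_space G \<mu>" x] hat.subspace_root_space
      hat.root_space_stable[OF hat_cartan_abelian]
    unfolding hat_root_space_def by metis
  then have "\<mu> = affine_weight \<nu> m"
    using hat.root_space_disjoint[of u "hat_cartan G" \<mu> "affine_weight \<nu> m"] \<mu>(1)
      affine_weight_dual roots_dual affine_indices_dual
    unfolding hat_root_space_def by blast
  then show ?thesis using that u(1) by blast
qed

text \<open>In \<open>D\<close> the imaginary root and the negative roots already carry one
  \<delta>, hence the \<open>k + 1\<close> for them.\<close>

lemma D_shift_eq:
  "D_shift G k = {affine_weight \<alpha> (int k) |\<alpha>. \<alpha> \<in> pos_roots G} \<union> {affine_weight 0 (int k + 1)}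
    \<union> {affine_weight \<alpha> (int k + 1) |\<alpha>. \<alpha> \<in> neg_roots G}"
proof -
  have *: "mult_delta G 1 + mult_delta G (int k) = mult_delta G (int k + 1)"
    "lift G \<alpha> + mult_delta G 1 + mult_delta G (int k) = lift G \<alpha> + mult_delta G (int k + 1)" for \<alpha>
    by (simp_all add: mult_delta_add add.assoc add.commute[of 1])
  show ?thesis
    unfolding D_shift_def D_def affine_weight_zero using * by (auto; metis)
qed

lemma zero_in_hat_cartan: "0 \<in> hat_cartan G"
  using hat_cartanI[OF subspace_0[OF cartan_subspace], of 0 0] by (simp add: zero_prod_def)

lemma zero_in_hat_n_plus: "0 \<in> hat_n_plus G"
  unfolding hat_n_plus_def by (rule hat.span_zero)

lemma hat_cartan_in_borel: "hat_cartan G \<subseteq> hat_borel G"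
  unfolding hat_borel_def using zero_in_hat_n_plus
  by (metis (mono_tags, lifting) add.right_neutral mem_Collect_eq subsetI)

lemma hat_n_plus_in_borel: "hat_n_plus G \<subseteq> hat_borel G"
  unfolding hat_borel_def using zero_in_hat_cartan
  by (metis (mono_tags, lifting) add.left_neutral mem_Collect_eq subsetI)

section \<open>Supports of ideals\<close>

context
  fixes I :: "'a affine set"
  assumes ideal: "hat.ideal_of (hat_borel G) I"
    and I_n_plus: "I \<subseteq> hat_n_plus G"
begin

lemma I_subspace: "hat.subspace I"
  using ideal by (simp add: hat.ideal_of_def)

lemma I_bracket: "x \<in> hat_borel G \<Longrightarrow> u \<in> I \<Longrightarrow> hat_bracket G x u \<in> I"
  using ideal by (simp add: hat.ideal_of_def)

text \<open>In positive degree \<open>x\<close> may be any element of the finite algebra. The bounds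
  make the total degree positive, so no central term arises.\<close>

lemma bracket_pos_degree:
  assumes "tensor_t y k \<in> I" "0 \<le> k" "0 < j"
  shows "tensor_t (bracket G x y) (k + j) \<in> I"
proof -
  have "tensor_t x j \<in> hat_n_plus G"
    unfolding hat_n_plus_def using assms(3) by (intro hat.span_base) auto
  then have "hat_bracket G (tensor_t x j) (tensor_t y k) \<in> I"
    using I_bracket assms(1) hat_n_plus_in_borel by blast
  then show ?thesis using assms(2,3) by (simp add: tensor_t_def hat_single_simps add.commute)
qed

text \<open>Degree 0 admits positive root vectors, and the central term vanishes since it is
  multiplied by the degree of the first factor.\<close>

lemma bracket_pos_root:
  assumes "tensor_t y k \<in> I" "\<alpha> \<in> pos_roots G" "x \<in> \<gg> \<alpha>"
  shows "tensor_t (bracket G x y) k \<in> I"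
proof -
  have "x \<in> n_plus G" unfolding n_plus_def using assms by (intro span_base) auto
  then have "tensor_t x 0 \<in> hat_n_plus G"
    unfolding hat_n_plus_def by (intro hat.span_base) auto
  then have "hat_bracket G (tensor_t x 0) (tensor_t y k) \<in> I"
    using I_bracket assms(1) hat_n_plus_in_borel by blast
  then show ?thesis by (simp add: tensor_t_def hat_single_simps split: if_splits)
qed

lemma tensor_t_unscale:
  assumes "tensor_t (smult G c y) k \<in> I" "c \<noteq> 0"
  shows "tensor_t y k \<in> I"
  using hat.subspace_scale[OF I_subspace assms(1), of "inverse c"] assms(2)
  by (simp flip: tensor_t_smult)

lemma tensor_t_uminus: "tensor_t y k \<in> I \<Longrightarrow> tensor_t (- y) k \<in> I"
  using hat.subspace_neg[OF I_subspace, of "tensor_t y k"] by (simp add: tensor_t_def single_uminus)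

text \<open>Reduces the support to pure tensors over the finite algebra. In the backward direction,
  \<open>I_n_plus\<close> supplies the vector that makes the weight a positive root.\<close>

lemma supp_iff:
  assumes "\<nu> \<in> insert 0 \<Delta>" "\<nu> \<noteq> 0 \<or> m \<noteq> 0"
  shows "affine_weight \<nu> m \<in> supp G I \<longleftrightarrow> (\<exists>y\<in>\<gg> \<nu>. y \<noteq> 0 \<and> tensor_t y m \<in> I)"
proof
  have zero: "0 \<in> I \<inter> hat_root_space G (affine_weight \<nu> m)"
    by (simp add: hat_root_space_def hat.subspace_0[OF hat.subspace_root_space] hat.subspace_0[OF I_subspace])
  assume "affine_weight \<nu> m \<in> supp G I"
  then obtain z where z: "z \<in> I" "z \<in> hat_root_space G (affine_weight \<nu> m)" "z \<noteq> 0"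
    using zero unfolding supp_def by blast
  then show "\<exists>y\<in>\<gg> \<nu>. y \<noteq> 0 \<and> tensor_t y m \<in> I"
    using hat_root_spaceE[OF z(2) roots_dual[OF assms(1)] assms(2)] by (metis tensor_t_eq_zero_iff)
next
  assume "\<exists>y\<in>\<gg> \<nu>. y \<noteq> 0 \<and> tensor_t y m \<in> I"
  then obtain y where y: "y \<in> \<gg> \<nu>" "y \<noteq> 0" "tensor_t y m \<in> I" by blast
  have z: "tensor_t y m \<in> hat_root_space G (affine_weight \<nu> m)" "tensor_t y m \<noteq> 0"
    using tensor_t_mem_root_space y by auto
  then have "affine_weight \<nu> m \<in> hat.roots (hat_cartan G)"
    using assms roots_dual affine_weight_dual affine_weight_nonzero
    unfolding hat_root_space_def by (intro hat.rootsI) auto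
  then show "affine_weight \<nu> m \<in> supp G I"
    using z y(3) I_n_plus unfolding supp_def hat_pos_roots_def by blast
qed

section \<open>Passing between real and imaginary roots of the support\<close>

text \<open>The opposite root is negative, so its vector is used in degree 1; this costs one
  \<delta>.\<close>

lemma pos_root_supp_delta:
  assumes "\<alpha> \<in> pos_roots G" "0 \<le> m" "affine_weight \<alpha> m \<in> supp G I"
  shows "affine_weight 0 (m + 1) \<in> supp G I"
proof -
  have \<alpha>: "\<alpha> \<in> \<Delta>" "\<alpha> \<noteq> 0" using assms(1) pos_roots_in_roots by (auto simp: roots_def)
  then obtain x where x: "x \<in> \<gg> \<alpha>" "x \<noteq> 0" "tensor_t x m \<in> I" using supp_iff assms(3) by blast
  obtain y where y: "bracket G x y \<in> \<hh>" "bracket G x y \<noteq> 0"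
    using opposite_root_vector[OF \<alpha>(1) x(1,2)] by blast
  have "tensor_t (bracket G y x) (m + 1) \<in> I" using bracket_pos_degree[OF x(3) assms(2)] by simp
  then have "tensor_t (bracket G x y) (m + 1) \<in> I" using tensor_t_uminus br_swap[of x y] by metis
  then show ?thesis using y assms(2) supp_iff[of 0 "m + 1"] by (auto simp: zero_root_space)
qed

text \<open>The opposite root is positive, so its vector is available in degree 0 and the degree
  does not change.\<close>

lemma neg_root_supp_delta:
  assumes "\<alpha> \<in> neg_roots G" "0 < m" "affine_weight \<alpha> m \<in> supp G I"
  shows "affine_weight 0 m \<in> supp G I"
proof -
  have \<alpha>: "\<alpha> \<in> \<Delta>" "\<alpha> \<noteq> 0" using assms(1) neg_roots_in_roots by (auto simp: roots_def)
  then obtain x where x: "x \<in> \<gg> \<alpha>" "x \<noteq> 0" "tensor_t x m \<in> I" using supp_iff assms(3) by blast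
  obtain y where y: "y \<in> \<gg> (- \<alpha>)" "bracket G x y \<in> \<hh>" "bracket G x y \<noteq> 0"
    using opposite_root_vector[OF \<alpha>(1) x(1,2)] by blast
  have "tensor_t (bracket G y x) m \<in> I"
    using bracket_pos_root[OF x(3) uminus_mem_pos_roots[OF assms(1)] y(1)] .
  then have "tensor_t (bracket G x y) m \<in> I" using tensor_t_uminus br_swap[of x y] by metis
  then show ?thesis using y assms(2) supp_iff[of 0 m] by (auto simp: zero_root_space)
qed

text \<open>The bracket of \<open>x\<close> with \<open>h\<close> is \<open>x\<close> scaled by the
  invertible number \<open>- \<alpha> h\<close>. The condition on \<open>j\<close> covers both ways
  of bracketing inside the Borel subalgebra.\<close>

lemma delta_supp_root_space:
  assumes h: "h \<in> \<hh>" "tensor_t h m \<in> I" and x: "x \<in> \<gg> \<alpha>" "\<alpha> h \<noteq> 0"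
    and j: "0 < j \<and> 0 \<le> m \<or> j = 0 \<and> \<alpha> \<in> pos_roots G"
  shows "tensor_t x (m + j) \<in> I"
proof -
  have "tensor_t (bracket G x h) (m + j) \<in> I"
    using j bracket_pos_degree[OF h(2)] bracket_pos_root[OF h(2) _ x(1)] by auto
  moreover have "bracket G x h = smult G (- \<alpha> h) x"
    using br_swap[of x h] root_space_mem[OF x(1) h(1)] by simp
  ultimately show ?thesis using tensor_t_unscale x(2) by (metis neg_equal_0_iff_equal)
qed

text \<open>The value of \<open>j\<close> is the degree that may be spent. Two brackets of degree 1
  serve any root; for a positive root one degree suffices, because a summand of it is positive and
  costs nothing.\<close>

lemma delta_supp_roots:
  assumes m: "0 < m" "affine_weight 0 m \<in> supp G I" and \<alpha>: "\<alpha> \<in> \<Delta>"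
    and j: "j = 2 \<or> j = 1 \<and> \<alpha> \<in> pos_roots G"
  shows "affine_weight \<alpha> (m + j) \<in> supp G I"
proof -
  obtain h where h: "h \<in> \<hh>" "h \<noteq> 0" "tensor_t h m \<in> I"
    using m supp_iff[of 0 m] by (auto simp: zero_root_space)
  have "\<exists>y\<in>\<gg> \<alpha>. y \<noteq> 0 \<and> tensor_t y (m + j) \<in> I"
  proof (cases "\<alpha> h = 0")
    case False
    obtain x where "x \<in> \<gg> \<alpha>" "x \<noteq> 0"
      using \<alpha> subspace_0[OF subspace_root_space] by (force simp: roots_def)
    then show ?thesis using delta_supp_root_space[where \<alpha> = \<alpha>, OF h(1,3) _ False] m(1) j by auto
  next
    case True
    obtain \<beta> \<gamma> y z where *: "\<beta> \<in> \<Delta>" "\<gamma> \<in> \<Delta>" "\<beta> h \<noteq> 0" "\<gamma> h \<noteq> 0" "\<alpha> = \<beta> + \<gamma>"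
      "y \<in> \<gg> \<beta>" "z \<in> \<gg> \<gamma>" "bracket G y z \<noteq> 0"
      using root_as_sum_nonzero_at[OF h(1,2) \<alpha> True] by blast
    have "tensor_t (bracket G y z) (m + j) \<in> I"
    proof (cases "j = 2")
      case True
      have "tensor_t z (m + 1) \<in> I"
        using delta_supp_root_space[OF h(1,3) *(7,4)] m(1) by simp
      then have "tensor_t (bracket G y z) (m + 1 + 1) \<in> I"
        using bracket_pos_degree[of z "m + 1" 1 y] m(1) by simp
      then show ?thesis using True by (simp add: add.commute)
    next
      case False
      then have "j = 1" "\<beta> + \<gamma> \<in> pos_roots G" using j * by auto
      \<comment> \<open>The positive summand is reached without raising the degree; the other one
        enters through the single bracket of degree 1.\<close>
      then consider "\<beta> \<in> pos_roots G" | "\<gamma> \<in> pos_roots G" using pos_root_summand * by blast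
      then show ?thesis
      proof cases
        case 1
        then have "tensor_t y m \<in> I" using delta_supp_root_space[OF h(1,3) *(6,3), of 0] by simp
        then have "tensor_t (bracket G z y) (m + j) \<in> I"
          using bracket_pos_degree m(1) \<open>j = 1\<close> by simp
        then show ?thesis using tensor_t_uminus br_swap[of y z] by metis
      next
        case 2
        then have "tensor_t z m \<in> I" using delta_supp_root_space[OF h(1,3) *(7,4), of 0] by simp
        then show ?thesis using bracket_pos_degree m(1) \<open>j = 1\<close> by simp
      qed
    qed
    moreover have "bracket G y z \<in> \<gg> \<alpha>" using br_root_space * by blast
    ultimately show ?thesis using * by blast
  qed
  then show ?thesis using supp_iff[of \<alpha> "m + j"] \<alpha> m(1) j by auto
qed

text \<open>Goes up to \<alpha> + m\<delta> by a positive root vector in degree 0, and from there to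
  (m+1)\<delta> by an opposite vector in degree 1.\<close>

lemma delta_supp_Suc:
  assumes m: "0 < m" "affine_weight 0 m \<in> supp G I"
  shows "affine_weight 0 (m + 1) \<in> supp G I"
proof -
  obtain h where h: "h \<in> \<hh>" "h \<noteq> 0" "tensor_t h m \<in> I"
    using m supp_iff[of 0 m] by (auto simp: zero_root_space)
  obtain \<alpha> where \<alpha>: "\<alpha> \<in> pos_roots G" "\<alpha> h \<noteq> 0" using pos_root_nonzero_at h by blast
  then obtain x where "x \<in> \<gg> \<alpha>" "x \<noteq> 0"
    using pos_roots_in_roots subspace_0[OF subspace_root_space] by (force simp: roots_def)
  moreover from this have "tensor_t x m \<in> I"
    using delta_supp_root_space[where \<alpha> = \<alpha> and j = 0, OF h(1,3) _ \<alpha>(2)] \<alpha> by simp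
  ultimately have "affine_weight \<alpha> m \<in> supp G I"
    using supp_iff[of \<alpha> m] m(1) pos_roots_in_roots[OF \<alpha>(1)] by auto
  then show ?thesis using pos_root_supp_delta \<alpha> m(1) by simp
qed

section \<open>Level and shape of the support\<close>

lemma supp_subset: "\<mu> \<in> supp G I \<Longrightarrow> \<exists>\<nu> m. (\<nu>, m) \<in> affine_indices \<and> \<mu> = affine_weight \<nu> m"
  using hat_pos_rootE by (metis (mono_tags, lifting) mem_Collect_eq supp_def)

text \<open>Ensures that the minimum defining \<open>level\<close> exists. The ideal contains a
  weight vector, and each kind of index leads to an imaginary root.\<close>

lemma delta_in_supp:
  assumes "I \<noteq> {0}"
  shows "\<exists>m>0. affine_weight 0 m \<in> supp G I"
proof -
  obtain x where x: "x \<in> I" "x \<noteq> 0" using assms hat.subspace_0[OF I_subspace] by blast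
  obtain \<nu> m u where u: "(\<nu>, m) \<in> affine_indices" "u \<in> I"
    "u \<in> hat_root_space G (affine_weight \<nu> m)" "u \<noteq> 0"
    using stable_meets_affine_weight[OF I_subspace _ _ x] I_bracket hat_cartan_in_borel I_n_plus x
    by blast
  obtain y where "y \<in> \<gg> \<nu>" "u = tensor_t y m"
    using hat_root_spaceE[OF u(3) roots_dual] u(1) affine_indices_dual affine_indices_nonzero by blast
  then have S: "affine_weight \<nu> m \<in> supp G I"
    using u supp_iff affine_indices_dual[OF u(1)] affine_indices_nonzero[OF u(1)] by auto
  consider "\<nu> \<in> pos_roots G" "0 \<le> m" | "\<nu> \<in> neg_roots G" "0 < m" | "\<nu> = 0" "0 < m"
    using u(1) roots_eq by (auto simp: affine_indices_def)
  then show ?thesis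
  proof cases
    case 1
    then show ?thesis using pos_root_supp_delta[OF _ _ S] by (intro exI[of _ "m + 1"]) simp
  next
    case 2
    then show ?thesis using neg_root_supp_delta[OF _ _ S] by blast
  qed (use S in blast)
qed

lemma supp_ideal:
  assumes nonzero: "I \<noteq> {0}" and l: "level G I = l"
  shows "supp G I =
      {mult_delta G (int l), mult_delta G (int l + 1)}
    \<union> {lift G \<alpha> + mult_delta G (int l - 1) | \<alpha>. \<alpha> \<in> a_plus G I}
    \<union> {lift G \<alpha> + mult_delta G (int l) | \<alpha>. \<alpha> \<in> a_minus G I \<union> a_plus' G I}
    \<union> {lift G \<alpha> + mult_delta G (int l + 1) | \<alpha>. \<alpha> \<in> a_minus' G I}
    \<union> (\<Union>k\<in>{l + 1..}. D_shift G k)" (is "_ = ?R")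
proof -
  obtain n where "0 < n" "affine_weight 0 n \<in> supp G I" using delta_in_supp[OF nonzero] by blast
  then have "\<exists>n>0. mult_delta G (int n) \<in> supp G I"
    unfolding affine_weight_zero by (intro exI[of _ "nat n"]) simp
  then have l0: "0 < l" "affine_weight 0 (int l) \<in> supp G I"
    unfolding l[symmetric] level_def affine_weight_zero by (metis (mono_tags, lifting) LeastI)+
  have least: "int l \<le> m" if "0 < m" "affine_weight 0 m \<in> supp G I" for m
  proof -
    have "l \<le> nat m"
      unfolding l[symmetric] level_def using that unfolding affine_weight_zero by (intro Least_le) simp
    then show ?thesis using that(1) by linarith
  qed
  have delta: "affine_weight 0 m \<in> supp G I" if "int l \<le> m" for m
    using that
  proof (induction m rule: int_ge_induct)
    case base
    show ?case by (rule l0)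
  next
    case (step m)
    then have "0 < m" using l0(1) by linarith
    then show ?case using delta_supp_Suc step.IH by blast
  qed
  have "\<mu> \<in> ?R" if \<mu>: "\<mu> \<in> supp G I" for \<mu>
  proof -
    obtain \<nu> m where \<nu>: "(\<nu>, m) \<in> affine_indices" "\<mu> = affine_weight \<nu> m"
      using supp_subset[OF \<mu>] by blast
    have shift: "\<mu> \<in> ?R" if "int l + 1 \<le> k" "\<mu> \<in> D_shift G (nat k)" for k
    proof -
      have "nat k \<in> {l + 1..}" using that(1) by auto
      then show ?thesis using that(2) by blast
    qed
    consider "\<nu> \<in> pos_roots G" "0 \<le> m" | "\<nu> \<in> neg_roots G" "0 < m" | "\<nu> = 0" "0 < m"
      using \<nu>(1) roots_eq by (auto simp: affine_indices_def)
    then show ?thesis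
    proof cases
      case 1
      \<comment> \<open>Minimality is applied at (m+1)\<delta>, so positive roots can occur one
        degree below the level.\<close>
      then have "int l \<le> m + 1" using least pos_root_supp_delta \<mu> \<nu>(2) by simp
      then consider "m = int l - 1" | "m = int l" | "int l + 1 \<le> m" by linarith
      then show ?thesis
      proof cases
        case 3
        then show ?thesis using shift[of m] 1 \<nu>(2) by (auto simp: D_shift_eq)
      qed (use 1 \<mu> \<nu>(2) l in \<open>auto simp: a_plus_def a_plus'_def\<close>)
    next
      case 2
      then have "int l \<le> m" using least neg_root_supp_delta \<mu> \<nu>(2) by simp
      \<comment> \<open>A negative root with m\<delta> belongs to \<open>D_shift G k\<close> for
        \<open>k = m - 1\<close>, so the tail starts at \<open>m = l + 2\<close>.\<close>
      then consider "m = int l" | "m = int l + 1" | "int l + 1 \<le> m - 1" by linarith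
      then show ?thesis
      proof cases
        case 3
        then show ?thesis using shift[of "m - 1"] 2 \<nu>(2) by (auto simp: D_shift_eq)
      qed (use 2 \<mu> \<nu>(2) l in \<open>auto simp: a_minus_def a_minus'_def\<close>)
    next
      case 3
      then have "int l \<le> m" using least \<mu> \<nu>(2) by simp
      then consider "m = int l" | "m = int l + 1" | "int l + 1 \<le> m - 1" by linarith
      then show ?thesis
      proof cases
        case 3
        then show ?thesis using shift[of "m - 1"] \<open>\<nu> = 0\<close> \<nu>(2) by (auto simp: D_shift_eq)
      qed (use 3 \<nu>(2) affine_weight_zero in auto)
    qed
  qed
  moreover have "\<mu> \<in> supp G I" if "k \<in> {l + 1..}" "\<mu> \<in> D_shift G k" for \<mu> k
  proof -
    \<comment> \<open>All of \<open>D_shift G k\<close> is reached from (k-1)\<delta>, which is in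
      the support as k-1 is at least \<open>l\<close>; the real roots use \<open>j = 1\<close> if
      positive and \<open>j = 2\<close> if negative.\<close>
    have k: "int l \<le> int k - 1" "0 < int k - 1" using that(1) l0(1) by auto
    have "affine_weight \<alpha> (int k) \<in> supp G I" if "\<alpha> \<in> pos_roots G" for \<alpha>
      using delta_supp_roots[OF k(2) delta[OF k(1)], of \<alpha> 1] that pos_roots_in_roots by simp
    moreover have "affine_weight \<alpha> (int k + 1) \<in> supp G I" if "\<alpha> \<in> neg_roots G" for \<alpha>
      using delta_supp_roots[OF k(2) delta[OF k(1)], of \<alpha> 2] that neg_roots_in_roots
      by (simp add: add.commute)
    moreover have "affine_weight 0 (int k + 1) \<in> supp G I" using delta k(1) by simp
    ultimately show ?thesis using that(2) unfolding D_shift_eq by blast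
  qed
  \<comment> \<open>The imaginary roots of the tail start at (l+2)\<delta>, which is why these two
    are listed separately.\<close>
  moreover have "mult_delta G (int l) \<in> supp G I" "mult_delta G (int l + 1) \<in> supp G I"
    using delta[of "int l"] delta[of "int l + 1"] by (simp_all add: affine_weight_zero)
  ultimately show ?thesis
    unfolding a_plus_def a_minus_def a_plus'_def a_minus'_def l by blast
qed

end

end

theorem proposition23:
  fixes G :: "'a::ab_group_add triangular_datum" and I :: "'a affine set" and l :: nat
  assumes "simple_triangular G"
    and "lie_algebra.ideal_of (hat_smult G) (hat_bracket G) (hat_borel G) I"
    and "I \<subseteq> hat_n_plus G"
    and "I \<noteq> {0}"
    and "level G I = l"
  shows "supp G I =
      {mult_delta G (int l), mult_delta G (int l + 1)}
    \<union> {lift G \<alpha> + mult_delta G (int l - 1) | \<alpha>. \<alpha> \<in> a_plus G I}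
    \<union> {lift G \<alpha> + mult_delta G (int l) | \<alpha>. \<alpha> \<in> a_minus G I \<union> a_plus' G I}
    \<union> {lift G \<alpha> + mult_delta G (int l + 1) | \<alpha>. \<alpha> \<in> a_minus' G I}
    \<union> (\<Union>k\<in>{l + 1..}. D_shift G k)"
  using simple_triangular.supp_ideal[OF assms] .

end
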